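(* Let $\rho=\prod_{k=1}^\infty(1-\alpha^k)^{t_k}$. As $n\to\infty$, we have $f_n\sim t_n/\rho$, i.e. $\lim_{n\to\infty} \rho f_n/t_n=1$.
   Context: An unlabeled tree (resp. forest) on $n$ vertices is an isomorphism class of trees (resp. acyclic simple graphs) with $n$ vertices; trees are unrooted. $t_n$ denotes the number of unlabeled trees on $n$ vertices and $f_n$ the number of unlabeled forests on $n$ vertices. Otter's constants $\alpha,\beta\in(0,\infty)$ are the constants for which $\lim_{n\to\infty}\alpha^n n^{5/2}t_n=\beta$ (this limit relation is Otter's theorem); $\alpha\approx0.338$, $\beta\approx 0.534$. *)

theory Defs
  imports "HOL-Analysis.Analysis" "HOL-Library.Landau_Symbols"
begin

(* A finite simple graph is given by its vertex set V and its set E of edges, which are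
   2-element subsets of V. The trees and forests of Graph_Theory are not usable here: they
   forbid directed cycles, and in a symmetric digraph every edge forms one of length 2. *)

definition simple_graph :: "'a set \<Rightarrow> 'a set set \<Rightarrow> bool" where
  "simple_graph V E \<longleftrightarrow> finite V \<and> (\<forall>e\<in>E. e \<subseteq> V \<and> card e = 2)"

definition graph_walk :: "'a set \<Rightarrow> 'a set set \<Rightarrow> 'a list \<Rightarrow> bool" where
  "graph_walk V E p \<longleftrightarrow>
     p \<noteq> [] \<and> set p \<subseteq> V \<and> (\<forall>i. Suc i < length p \<longrightarrow> {p ! i, p ! Suc i} \<in> E)"

(* The graph without vertices does not count as connected, so it is a forest but not a tree. *)
definition connected_graph :: "'a set \<Rightarrow> 'a set set \<Rightarrow> bool" where
  "connected_graph V E \<longleftrightarrow>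
     V \<noteq> {} \<and> (\<forall>u\<in>V. \<forall>v\<in>V. \<exists>p. graph_walk V E p \<and> hd p = u \<and> last p = v)"

definition graph_cycle :: "'a set \<Rightarrow> 'a set set \<Rightarrow> 'a list \<Rightarrow> bool" where
  "graph_cycle V E p \<longleftrightarrow>
     graph_walk V E p \<and> length p \<ge> 3 \<and> distinct p \<and> {last p, hd p} \<in> E"

definition forest :: "'a set \<Rightarrow> 'a set set \<Rightarrow> bool" where
  "forest V E \<longleftrightarrow> simple_graph V E \<and> (\<nexists>p. graph_cycle V E p)"

definition tree :: "'a set \<Rightarrow> 'a set set \<Rightarrow> bool" where
  "tree V E \<longleftrightarrow> forest V E \<and> connected_graph V E"

definition graph_iso :: "'a set \<Rightarrow> 'a set set \<Rightarrow> 'b set \<Rightarrow> 'b set set \<Rightarrow> bool" where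
  "graph_iso V E W F \<longleftrightarrow> (\<exists>f. bij_betw f V W \<and> F = (\<lambda>e. f ` e) ` E)"

(* Every isomorphism class of graphs with n vertices has representatives with vertex set
   {..<n}, so the classes are counted as classes of edge sets on {..<n}. *)
definition iso_rel :: "nat \<Rightarrow> (nat set set \<times> nat set set) set" where
  "iso_rel n = {(E, F). simple_graph {..<n} E \<and> simple_graph {..<n} F \<and>
                        graph_iso {..<n} E {..<n} F}"

lemma equiv_iso_rel: "equiv {E. simple_graph {..<n} E} (iso_rel n)"
proof (rule equivI)
  show "iso_rel n \<subseteq> {E. simple_graph {..<n} E} \<times> {E. simple_graph {..<n} E}"
    by (auto simp: iso_rel_def)
  show "refl_on {E. simple_graph {..<n} E} (iso_rel n)"
    by (auto simp: refl_on_def iso_rel_def graph_iso_def intro!: exI[of _ id])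
  show "sym (iso_rel n)"
  proof (rule symI)
    fix E F assume "(E, F) \<in> iso_rel n"
    then obtain f where EF: "simple_graph {..<n} E" "simple_graph {..<n} F"
      and f: "bij_betw f {..<n} {..<n}" "F = (\<lambda>e. f ` e) ` E"
      by (auto simp: iso_rel_def graph_iso_def)
    let ?g = "inv_into {..<n} f"
    have "?g ` f ` e = e" if "e \<in> E" for e
      using that EF(1) bij_betw_imp_inj_on[OF f(1)] inv_into_image_cancel
      unfolding simple_graph_def by metis
    then have "E = (\<lambda>e. ?g ` e) ` F"
      unfolding f(2) image_image by simp
    then show "(F, E) \<in> iso_rel n"
      using EF bij_betw_inv_into[OF f(1)] by (auto simp: iso_rel_def graph_iso_def)
  qed
  show "trans (iso_rel n)"
  proof (rule transI)
    fix E F G assume "(E, F) \<in> iso_rel n" "(F, G) \<in> iso_rel n"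
    then obtain f g where S: "simple_graph {..<n} E" "simple_graph {..<n} G"
      and f: "bij_betw f {..<n} {..<n}" "F = (\<lambda>e. f ` e) ` E"
      and g: "bij_betw g {..<n} {..<n}" "G = (\<lambda>e. g ` e) ` F"
      by (auto simp: iso_rel_def graph_iso_def)
    have "G = (\<lambda>e. (g \<circ> f) ` e) ` E"
      unfolding g(2) f(2) by (simp add: image_image)
    then show "(E, G) \<in> iso_rel n"
      using S bij_betw_trans[OF f(1) g(1)] unfolding iso_rel_def graph_iso_def by blast
  qed
qed

definition num_unlabeled_trees :: "nat \<Rightarrow> nat" where
  "num_unlabeled_trees n = card ({E. tree {..<n} E} // iso_rel n)"

definition num_unlabeled_forests :: "nat \<Rightarrow> nat" where
  "num_unlabeled_forests n = card ({E. forest {..<n} E} // iso_rel n)"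

end

theory Submission
  imports Defs "HOL-Real_Asymp.Real_Asymp"
begin

text \<open>
  A forest is determined up to isomorphism by the multiset of the isomorphism classes of its
  components (\<open>num_unlabeled_forests_eq\<close>). So the generating function of the numbers \<open>f n\<close> of
  unlabeled forests is the product of \<open>1 / (1 - z ^ k) ^ t k\<close> over \<open>k \<ge> 1\<close>, where \<open>t k\<close> is the number
  of unlabeled trees, and \<open>1 / \<rho>\<close> is its value at \<open>z = \<alpha>\<close>
  (\<open>weighted_msets_partial_products\<close>).

  Since \<open>n powr (- 5 / 2)\<close> decays subexponentially and is summable, a large forest typically
  consists of one huge tree and a bounded rest. The weighted number of possible rests is the value
  \<open>1 / \<rho>\<close> of the generating function, and this is the limit of \<open>f n / t n\<close>. The proof makes this
  precise with the recurrence
  \[ n f_n = \sum_{k=1}^n \Big(\sum_{d \mid k} d\, t_d\Big) f_{n-k}, \]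
  which counts the vertices of all forests with \<open>n\<close> vertices in two ways
  (\<open>weighted_msets_recurrence\<close>). After multiplication by \<open>\<alpha> ^ n\<close> it has the form
  \<open>n * b n = (\<Sum>k\<le>n. w k * b (n - k))\<close> with \<open>b n = \<alpha> ^ n * f n\<close> and \<open>w k \<sim> \<beta> * k powr (- 3 / 2)\<close>;
  in \<open>w k\<close> the proper divisors of \<open>k\<close> contribute only an exponentially small error
  (\<open>divisor_sum_asymptotics\<close>). This form alone forces \<open>b\<close> to be summable with
  \<open>b n \<sim> \<beta> * suminf b * n powr (- 5 / 2)\<close> (\<open>convolution_recurrence_asymptotics\<close>). Dividing by
  \<open>\<alpha> ^ n * t n \<sim> \<beta> * n powr (- 5 / 2)\<close> gives the limit \<open>suminf b = 1 / \<rho>\<close>.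
\<close>

section \<open>Graph isomorphisms\<close>

lemma graph_walk_image:
  assumes "graph_walk V E p" and "f ` V \<subseteq> W"
  shows "graph_walk W ((\<lambda>e. f ` e) ` E) (map f p)"
  unfolding graph_walk_def
proof (intro conjI allI impI)
  show "map f p \<noteq> []" "set (map f p) \<subseteq> W"
    using assms by (auto simp: graph_walk_def)
  fix i assume i: "Suc i < length (map f p)"
  then have "{p ! i, p ! Suc i} \<in> E"
    using assms(1) by (auto simp: graph_walk_def)
  then have "f ` {p ! i, p ! Suc i} \<in> (\<lambda>e. f ` e) ` E"
    by (rule imageI)
  then show "{map f p ! i, map f p ! Suc i} \<in> (\<lambda>e. f ` e) ` E"
    using i by simp
qed

lemma graph_walk_snoc:
  assumes "graph_walk V E p" and "x \<in> V" and "{last p, x} \<in> E"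
  shows "graph_walk V E (p @ [x])"
  unfolding graph_walk_def
proof (intro conjI allI impI)
  show "p @ [x] \<noteq> []" "set (p @ [x]) \<subseteq> V"
    using assms by (auto simp: graph_walk_def)
  fix i assume i: "Suc i < length (p @ [x])"
  show "{(p @ [x]) ! i, (p @ [x]) ! Suc i} \<in> E"
  proof (cases "Suc i < length p")
    case True
    then show ?thesis
      using assms(1) by (auto simp: graph_walk_def nth_append)
  next
    case False
    then have "i = length p - 1" "p \<noteq> []"
      using i assms(1) by (auto simp: graph_walk_def)
    then show ?thesis
      using assms(3) by (simp add: nth_append last_conv_nth)
  qed
qed

lemma graph_iso_sym:
  assumes "simple_graph V E" and "graph_iso V E W F"
  shows "graph_iso W F V E"
proof -
  obtain f where f: "bij_betw f V W" "F = (\<lambda>e. f ` e) ` E"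
    using assms(2) by (auto simp: graph_iso_def)
  let ?g = "inv_into V f"
  have "?g ` f ` e = e" if "e \<in> E" for e
    using that assms(1) bij_betw_imp_inj_on[OF f(1)] inv_into_image_cancel
    unfolding simple_graph_def by metis
  then have "E = (\<lambda>e. ?g ` e) ` F"
    unfolding f(2) image_image by simp
  then show ?thesis
    using bij_betw_inv_into[OF f(1)] by (auto simp: graph_iso_def)
qed

lemma graph_iso_trans:
  assumes "graph_iso U D V E" and "graph_iso V E W F"
  shows "graph_iso U D W F"
proof -
  obtain f where f: "bij_betw f U V" "E = (\<lambda>e. f ` e) ` D"
    using assms(1) by (auto simp: graph_iso_def)
  obtain g where g: "bij_betw g V W" "F = (\<lambda>e. g ` e) ` E"
    using assms(2) by (auto simp: graph_iso_def)
  have "F = (\<lambda>e. (g \<circ> f) ` e) ` D"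
    unfolding g(2) f(2) by (simp add: image_image)
  then show ?thesis
    using bij_betw_trans[OF f(1) g(1)] unfolding graph_iso_def by blast
qed

lemma simple_graph_iso:
  assumes "simple_graph V E" and "graph_iso V E W F"
  shows "simple_graph W F"
proof -
  obtain f where f: "bij_betw f V W" "F = (\<lambda>e. f ` e) ` E"
    using assms(2) by (auto simp: graph_iso_def)
  have "f ` e \<subseteq> W \<and> card (f ` e) = 2" if "e \<in> E" for e
  proof -
    have "e \<subseteq> V" "card e = 2"
      using that assms(1) by (auto simp: simple_graph_def)
    moreover have "inj_on f e"
      using f(1) \<open>e \<subseteq> V\<close> by (auto simp: bij_betw_def intro: inj_on_subset)
    ultimately show ?thesis
      using f(1) by (auto simp: bij_betw_def card_image)
  qed
  moreover have "finite W"
    using assms(1) f(1) bij_betw_finite by (auto simp: simple_graph_def)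
  ultimately show ?thesis
    unfolding simple_graph_def f(2) by blast
qed

lemma connected_graph_iso:
  assumes "connected_graph V E" and "graph_iso V E W F"
  shows "connected_graph W F"
proof -
  obtain f where f: "bij_betw f V W" "F = (\<lambda>e. f ` e) ` E"
    using assms(2) by (auto simp: graph_iso_def)
  have W: "W = f ` V"
    using f(1) by (simp add: bij_betw_def)
  have "\<exists>p. graph_walk W F p \<and> hd p = f u \<and> last p = f v" if uv: "u \<in> V" "v \<in> V" for u v
  proof -
    obtain p where p: "graph_walk V E p" "hd p = u" "last p = v"
      using uv assms(1) by (auto simp: connected_graph_def)
    have "p \<noteq> []"
      using p(1) by (simp add: graph_walk_def)
    then have "hd (map f p) = f u" "last (map f p) = f v"
      using p by (simp_all add: hd_map last_map)
    moreover have "graph_walk W F (map f p)"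
      using graph_walk_image[OF p(1), of f W] unfolding W f(2) by simp
    ultimately show ?thesis by blast
  qed
  moreover have "W \<noteq> {}"
    using assms(1) by (auto simp: W connected_graph_def)
  ultimately show ?thesis
    unfolding connected_graph_def W by blast
qed

lemma graph_cycle_iso:
  assumes "graph_cycle V E p" and "graph_iso V E W F"
  shows "\<exists>q. graph_cycle W F q"
proof -
  obtain f where f: "bij_betw f V W" "F = (\<lambda>e. f ` e) ` E"
    using assms(2) by (auto simp: graph_iso_def)
  have p: "graph_walk V E p" "length p \<ge> 3" "distinct p" "{last p, hd p} \<in> E" "set p \<subseteq> V" "p \<noteq> []"
    using assms(1) by (auto simp: graph_cycle_def graph_walk_def)
  have "graph_walk W F (map f p)"
    using graph_walk_image[OF p(1)] f by (auto simp: bij_betw_def)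
  moreover have "distinct (map f p)"
    using p f(1) by (auto simp: distinct_map bij_betw_def intro: inj_on_subset)
  moreover have "{last (map f p), hd (map f p)} \<in> F"
    using imageI[OF p(4), of "\<lambda>e. f ` e"] p(6) by (simp add: f(2) last_map hd_map)
  ultimately have "graph_cycle W F (map f p)"
    using p(2) by (simp add: graph_cycle_def)
  then show ?thesis ..
qed

lemma forest_iso:
  assumes "forest V E" and "graph_iso V E W F"
  shows "forest W F"
  using assms simple_graph_iso graph_iso_sym graph_cycle_iso
  unfolding forest_def by metis

lemma tree_iso: "tree V E \<Longrightarrow> graph_iso V E W F \<Longrightarrow> tree W F"
  using forest_iso connected_graph_iso unfolding tree_def by blast

lemma graph_iso_card: "graph_iso V E W F \<Longrightarrow> card V = card W"
  unfolding graph_iso_def using bij_betw_same_card by blast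

lemma graph_iso_image: "inj_on f V \<Longrightarrow> graph_iso V E (f ` V) ((\<lambda>e. f ` e) ` E)"
  unfolding graph_iso_def by (intro exI[of _ f]) (simp add: bij_betw_def)

lemma graph_iso_Un:
  assumes "simple_graph V E" "simple_graph V' E'" and "V \<inter> V' = {}" "W \<inter> W' = {}"
    and "graph_iso V E W F" "graph_iso V' E' W' F'"
  shows "graph_iso (V \<union> V') (E \<union> E') (W \<union> W') (F \<union> F')"
proof -
  obtain f where f: "bij_betw f V W" "F = (\<lambda>e. f ` e) ` E"
    using assms by (auto simp: graph_iso_def)
  obtain g where g: "bij_betw g V' W'" "F' = (\<lambda>e. g ` e) ` E'"
    using assms by (auto simp: graph_iso_def)
  let ?h = "\<lambda>x. if x \<in> V then f x else g x"
  have E: "?h ` e = f ` e" if "e \<in> E" for e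
  proof (rule image_cong)
    fix x assume "x \<in> e"
    then have "x \<in> V"
      using that assms(1) by (auto simp: simple_graph_def)
    then show "?h x = f x" by simp
  qed simp
  have E': "?h ` e = g ` e" if "e \<in> E'" for e
  proof (rule image_cong)
    fix x assume "x \<in> e"
    then have "x \<notin> V"
      using that assms(2,3) by (auto simp: simple_graph_def)
    then show "?h x = g x" by simp
  qed simp
  have "(\<lambda>e. ?h ` e) ` E = (\<lambda>e. f ` e) ` E" "(\<lambda>e. ?h ` e) ` E' = (\<lambda>e. g ` e) ` E'"
    by (rule image_cong[OF refl E], assumption) (rule image_cong[OF refl E'], assumption)
  then have "F \<union> F' = (\<lambda>e. ?h ` e) ` (E \<union> E')"
    unfolding f(2) g(2) image_Un by (simp only:)
  then show ?thesis
    using bij_betw_disjoint_Un[OF f(1) g(1) assms(3,4)] unfolding graph_iso_def by blast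
qed

lemma ex_graph_iso_lessThan:
  assumes "simple_graph V E"
  shows "\<exists>F. simple_graph {..<card V} F \<and> graph_iso V E {..<card V} F"
proof -
  obtain f where "bij_betw f V {..<card V}"
    using assms ex_bij_betw_finite_nat[of V] by (auto simp: simple_graph_def atLeast0LessThan)
  then have "graph_iso V E {..<card V} ((\<lambda>e. f ` e) ` E)"
    by (auto simp: graph_iso_def)
  then show ?thesis
    using simple_graph_iso[OF assms] by blast
qed

section \<open>Connected components\<close>

definition edge_closed :: "'a set set \<Rightarrow> 'a set \<Rightarrow> bool" where
  "edge_closed E S \<longleftrightarrow> (\<forall>e\<in>E. e \<inter> S \<noteq> {} \<longrightarrow> e \<subseteq> S)"

lemma graph_walk_edge_closed:
  assumes "graph_walk V E p" and "edge_closed E S" and "hd p \<in> S"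
  shows "set p \<subseteq> S"
proof -
  have "p ! i \<in> S" if "i < length p" for i
    using that
  proof (induction i)
    case 0
    then show ?case
      using assms(3) by (simp add: hd_conv_nth)
  next
    case (Suc i)
    then have "{p ! i, p ! Suc i} \<in> E" "p ! i \<in> S"
      using assms(1) by (auto simp: graph_walk_def)
    then show ?case
      using assms(2) by (auto simp: edge_closed_def)
  qed
  then show ?thesis
    by (auto simp: in_set_conv_nth)
qed

lemma connected_graph_edge_closed:
  assumes "connected_graph V E" and "edge_closed E S" and "S \<inter> V \<noteq> {}"
  shows "V \<subseteq> S"
proof
  fix v assume "v \<in> V"
  obtain u where "u \<in> S" "u \<in> V"
    using assms(3) by blast
  then obtain p where p: "graph_walk V E p" "hd p = u" "last p = v"
    using assms(1) \<open>v \<in> V\<close> by (auto simp: connected_graph_def)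
  then have "set p \<subseteq> S"
    using graph_walk_edge_closed[OF p(1) assms(2)] \<open>u \<in> S\<close> by simp
  moreover have "p \<noteq> []"
    using p(1) by (simp add: graph_walk_def)
  ultimately show "v \<in> S"
    using p(3) last_in_set by blast
qed

text \<open>Describing components as connected induced subgraphs that no edge leaves, instead of as classes
  of the reachability relation, reduces most arguments about them to the fact that a walk cannot
  leave an edge-closed set.\<close>
definition components :: "'a set \<Rightarrow> 'a set set \<Rightarrow> 'a set set" where
  "components V E = {C. C \<subseteq> V \<and> edge_closed E C \<and> connected_graph C (E \<inter> Pow C)}"

lemma components_empty: "components {} E = {}"
  by (auto simp: components_def connected_graph_def)

lemma finite_components: "finite V \<Longrightarrow> finite (components V E)"
  by (rule finite_subset[of _ "Pow V"]) (auto simp: components_def)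

text \<open>A nonempty edge-closed set of least cardinality is connected, because the set of vertices
  that can be reached from one of its vertices is edge-closed as well.\<close>
lemma ex_component:
  assumes G: "simple_graph V E" and "V \<noteq> {}"
  shows "\<exists>C. C \<in> components V E"
proof -
  define P where "P C \<longleftrightarrow> C \<subseteq> V \<and> C \<noteq> {} \<and> edge_closed E C" for C
  have "P V"
    using assms by (auto simp: P_def edge_closed_def simple_graph_def)
  then obtain C where C: "P C" and least: "\<And>D. P D \<Longrightarrow> card C \<le> card D"
    using ex_has_least_nat[of P V card] by blast
  have "finite C"
    using C G by (auto simp: P_def simple_graph_def intro: finite_subset)
  let ?E = "E \<inter> Pow C"
  have "\<exists>p. graph_walk C ?E p \<and> hd p = u \<and> last p = v" if "u \<in> C" "v \<in> C" for u v
  proof -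
    define R where "R = {w. \<exists>p. graph_walk C ?E p \<and> hd p = u \<and> last p = w}"
    have "R \<subseteq> C"
      unfolding R_def graph_walk_def using last_in_set by blast
    have "graph_walk C ?E [u]"
      using that by (simp add: graph_walk_def)
    then have "u \<in> R"
      unfolding R_def by force
    have "edge_closed E R"
      unfolding edge_closed_def
    proof (intro ballI impI subsetI)
      fix e x assume e: "e \<in> E" "e \<inter> R \<noteq> {}" and x: "x \<in> e"
      have "e \<inter> C \<noteq> {}"
        using e(2) \<open>R \<subseteq> C\<close> by blast
      then have "e \<subseteq> C"
        using C e by (auto simp: P_def edge_closed_def)
      obtain w where w: "w \<in> e" "w \<in> R"
        using e(2) by blast
      then obtain p where p: "graph_walk C ?E p" "hd p = u" "last p = w"
        by (auto simp: R_def)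
      show "x \<in> R"
      proof (cases "x = w")
        case False
        have "card e = 2"
          using G e by (auto simp: simple_graph_def)
        then have "e = {w, x}"
          using x w(1) False by (auto simp: card_2_iff)
        then have "graph_walk C ?E (p @ [x])"
          using p e \<open>e \<subseteq> C\<close> by (intro graph_walk_snoc) auto
        moreover have "hd (p @ [x]) = u"
          using p by (auto simp: graph_walk_def)
        ultimately show ?thesis
          unfolding R_def by force
      qed (use w in simp)
    qed
    then have "card C \<le> card R"
      using \<open>u \<in> R\<close> \<open>R \<subseteq> C\<close> C by (intro least) (auto simp: P_def)
    then have "R = C"
      using \<open>R \<subseteq> C\<close> \<open>finite C\<close> by (simp add: card_seteq)
    then show ?thesis
      using that unfolding R_def by blast
  qed
  then have "C \<in> components V E"
    using C by (auto simp: components_def connected_graph_def P_def)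
  then show ?thesis ..
qed

lemma simple_graph_subgraph:
  "simple_graph V E \<Longrightarrow> U \<subseteq> V \<Longrightarrow> simple_graph U (E \<inter> Pow U)"
  by (auto simp: simple_graph_def intro: finite_subset)

lemma forest_subgraph:
  assumes "forest V E" and "U \<subseteq> V"
  shows "forest U (E \<inter> Pow U)"
proof -
  have "graph_cycle V E p" if "graph_cycle U (E \<inter> Pow U) p" for p
    using that assms(2) by (auto simp: graph_cycle_def graph_walk_def)
  then show ?thesis
    using assms simple_graph_subgraph unfolding forest_def by blast
qed

lemma component_split:
  assumes "simple_graph V E" and "C \<in> components V E"
  shows "V = (V - C) \<union> C" and "E = (E \<inter> Pow (V - C)) \<union> (E \<inter> Pow C)"
  using assms by (auto simp: components_def simple_graph_def edge_closed_def)

lemma tree_component: "forest V E \<Longrightarrow> C \<in> components V E \<Longrightarrow> tree C (E \<inter> Pow C)"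
  by (auto simp: tree_def components_def intro: forest_subgraph)

lemma simple_graph_Un:
  "simple_graph V E \<Longrightarrow> simple_graph W F \<Longrightarrow> simple_graph (V \<union> W) (E \<union> F)"
  by (auto simp: simple_graph_def)

lemma disjoint_Un_restrict:
  assumes "simple_graph V E" "simple_graph W F" and "V \<inter> W = {}" and "C \<subseteq> V"
  shows "(E \<union> F) \<inter> Pow C = E \<inter> Pow C"
proof -
  have False if "e \<in> F" "e \<subseteq> C" for e
  proof -
    have "e \<subseteq> W" "card e = 2"
      using that assms(2) by (auto simp: simple_graph_def)
    then show False
      using that assms(3,4) by (auto simp: card_2_iff)
  qed
  then show ?thesis by blast
qed

lemma edge_closed_disjoint_Un:
  assumes "simple_graph V E" "simple_graph W F" and "V \<inter> W = {}"
  shows "edge_closed (E \<union> F) V" and "edge_closed (E \<union> F) W"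
proof -
  have "e \<subseteq> V" if "e \<in> E" for e
    using that assms(1) by (auto simp: simple_graph_def)
  moreover have "e \<subseteq> W" if "e \<in> F" for e
    using that assms(2) by (auto simp: simple_graph_def)
  ultimately show "edge_closed (E \<union> F) V" "edge_closed (E \<union> F) W"
    using assms(3) unfolding edge_closed_def by blast+
qed

lemma edge_closed_subset: "edge_closed E S \<Longrightarrow> D \<subseteq> E \<Longrightarrow> edge_closed D S"
  by (auto simp: edge_closed_def)

text \<open>In a disjoint union both sides are edge-closed. A component, being connected, therefore lies
  on one side, and on the connected side it is everything.\<close>
lemma components_disjoint_Un:
  assumes G: "simple_graph V E" "simple_graph W F" and W: "connected_graph W F"
    and disj: "V \<inter> W = {}"
  shows "components (V \<union> W) (E \<union> F) = insert W (components V E)"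
proof (intro equalityI subsetI)
  fix C assume "C \<in> components (V \<union> W) (E \<union> F)"
  then have C: "C \<subseteq> V \<union> W" "edge_closed (E \<union> F) C" "connected_graph C ((E \<union> F) \<inter> Pow C)"
    by (auto simp: components_def)
  have sub: "C \<subseteq> S" if "edge_closed (E \<union> F) S" "S \<inter> C \<noteq> {}" for S
    by (rule connected_graph_edge_closed[OF C(3) edge_closed_subset[OF that(1)]]) (use that in auto)
  show "C \<in> insert W (components V E)"
  proof (cases "C \<inter> W = {}")
    case True
    then have "C \<subseteq> V" using C by blast
    moreover have "connected_graph C (E \<inter> Pow C)"
      using C(3) disjoint_Un_restrict[OF G disj \<open>C \<subseteq> V\<close>] by (simp only:)
    moreover have "edge_closed E C"
      using edge_closed_subset[OF C(2)] by blast
    ultimately show ?thesis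
      by (simp add: components_def)
  next
    case False
    then have "C \<subseteq> W"
      using sub edge_closed_disjoint_Un[OF G disj] by blast
    moreover have "W \<subseteq> C"
      by (rule connected_graph_edge_closed[OF W edge_closed_subset[OF C(2)]]) (use False in auto)
    ultimately show ?thesis by blast
  qed
next
  fix C assume "C \<in> insert W (components V E)"
  then show "C \<in> components (V \<union> W) (E \<union> F)"
  proof
    assume "C = W"
    have "(E \<union> F) \<inter> Pow W = F \<inter> Pow W"
      using disjoint_Un_restrict[OF G(2,1), of W] disj by (simp add: Un_commute Int_commute)
    also have "F \<inter> Pow W = F"
      using G(2) by (auto simp: simple_graph_def)
    finally show ?thesis
      using W edge_closed_disjoint_Un(2)[OF G disj] \<open>C = W\<close> by (simp add: components_def)
  next
    assume "C \<in> components V E"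
    then have C: "C \<subseteq> V" "edge_closed E C" "connected_graph C (E \<inter> Pow C)"
      by (auto simp: components_def)
    have "e \<inter> C = {}" if "e \<in> F" for e
      using that G(2) disj C(1) by (fastforce simp: simple_graph_def)
    then have "edge_closed (E \<union> F) C"
      using C(2) by (auto simp: edge_closed_def)
    then show ?thesis
      using C disjoint_Un_restrict[OF G disj C(1)] by (simp add: components_def le_supI1)
  qed
qed

text \<open>A cycle of a disjoint union stays on the side on which it starts.\<close>
lemma forest_disjoint_Un:
  assumes "forest V E" "forest W F" and disj: "V \<inter> W = {}"
  shows "forest (V \<union> W) (E \<union> F)"
proof -
  have G: "simple_graph V E" "simple_graph W F"
    using assms by (auto simp: forest_def)
  have "graph_cycle V E p \<or> graph_cycle W F p" if "graph_cycle (V \<union> W) (E \<union> F) p" for p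
  proof -
    have p: "graph_walk (V \<union> W) (E \<union> F) p" "length p \<ge> 3" "distinct p" "{last p, hd p} \<in> E \<union> F"
        "p \<noteq> []"
      using that by (auto simp: graph_cycle_def graph_walk_def)
    have *: "graph_cycle S D p"
      if "simple_graph S D" "simple_graph S' D'" "S \<inter> S' = {}" "E \<union> F = D \<union> D'" "hd p \<in> S" 
      for S S' D D'
    proof -
      have "set p \<subseteq> S"
        using graph_walk_edge_closed[OF p(1)] edge_closed_disjoint_Un[OF that(1-3)] that(4,5) by auto
      have "{x, y} \<in> D" if "x \<in> S" "{x, y} \<in> E \<union> F" for x y
      proof -
        have "e \<subseteq> S'" if "e \<in> D'" for e
          using that \<open>simple_graph S' D'\<close> by (simp add: simple_graph_def)
        then show ?thesis
          using that \<open>S \<inter> S' = {}\<close> \<open>E \<union> F = D \<union> D'\<close> by blast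
      qed
      then show ?thesis
        using p \<open>set p \<subseteq> S\<close> by (auto simp: graph_cycle_def graph_walk_def subset_iff)
    qed
    have "hd p \<in> V \<union> W"
      using p(1,5) hd_in_set by (auto simp: graph_walk_def)
    then show ?thesis
      using *[OF G disj] *[OF G(2,1)] disj by (auto simp: Un_commute)
  qed
  then show ?thesis
    using assms simple_graph_Un unfolding forest_def by blast
qed

text \<open>Every nonempty forest is the disjoint union of a smaller forest and one of its components,
  which is a tree. Statements about the multiset of components of a forest thus reduce to the
  removal of one tree.\<close>
lemma forest_induct [consumes 1, case_names empty add_tree]:
  assumes "forest V E" and "P {} {}"
    and step: "\<And>V E W F. forest V E \<Longrightarrow> P V E \<Longrightarrow> tree W F \<Longrightarrow> V \<inter> W = {} \<Longrightarrow> P (V \<union> W) (E \<union> F)"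
  shows "P V E"
  using assms(1)
proof (induction "card V" arbitrary: V E rule: less_induct)
  case less
  have G: "simple_graph V E"
    using less.prems by (simp add: forest_def)
  show ?case
  proof (cases "V = {}")
    case True
    then have "E = {}"
      using G by (auto simp: simple_graph_def)
    then show ?thesis
      using assms(2) True by simp
  next
    case False
    then obtain C where C: "C \<in> components V E"
      using ex_component[OF G] by blast
    then have "C \<subseteq> V" "C \<noteq> {}"
      by (auto simp: components_def connected_graph_def)
    moreover have "finite V"
      using G by (simp add: simple_graph_def)
    ultimately have "card (V - C) < card V"
      by (intro psubset_card_mono) auto
    moreover have "forest (V - C) (E \<inter> Pow (V - C))"
      by (rule forest_subgraph[OF less.prems]) blast
    ultimately have "P (V - C \<union> C) ((E \<inter> Pow (V - C)) \<union> (E \<inter> Pow C))"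
      using less.hyps less.prems C by (intro step tree_component) auto
    then show ?thesis
      using component_split[OF G C] by simp
  qed
qed

section \<open>Forests as multisets of unlabeled trees\<close>

text \<open>The shape of a graph is a complete isomorphism invariant: for a tree with \<open>k\<close> vertices it is
  \<open>k\<close> together with one of the classes that \<^const>\<open>num_unlabeled_trees\<close> counts. Keeping the number
  of vertices makes the shapes of trees of all sizes one set, in which the size can be read off.\<close>
definition shape :: "'a set \<Rightarrow> 'a set set \<Rightarrow> nat \<times> nat set set set" where
  "shape V E = (card V, {F. simple_graph {..<card V} F \<and> graph_iso V E {..<card V} F})"

lemma shape_eq_iff:
  assumes "simple_graph V E" and "simple_graph W F"
  shows "shape V E = shape W F \<longleftrightarrow> graph_iso V E W F"
proof
  assume eq: "shape V E = shape W F"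
  obtain D where "simple_graph {..<card V} D" "graph_iso V E {..<card V} D"
    using ex_graph_iso_lessThan[OF assms(1)] by blast
  moreover then have "D \<in> snd (shape V E)"
    by (simp add: shape_def)
  then have "D \<in> snd (shape W F)"
    unfolding eq .
  then have "graph_iso W F {..<card V} D"
    using eq by (simp add: shape_def)
  ultimately show "graph_iso V E W F"
    using graph_iso_sym[OF assms(2)] graph_iso_trans by blast
next
  assume iso: "graph_iso V E W F"
  then have "graph_iso W F V E"
    using graph_iso_sym assms(1) by blast
  then have "graph_iso V E U D \<longleftrightarrow> graph_iso W F U D" for U :: "nat set" and D
    using graph_iso_trans[of W F V E U D] graph_iso_trans[of V E W F U D] iso by blast
  then show "shape V E = shape W F"
    by (simp add: shape_def graph_iso_card[OF iso])
qed

definition tree_shapes :: "(nat \<times> nat set set set) set" where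
  "tree_shapes = (SIGMA k:UNIV. {E. tree {..<k} E} // iso_rel k)"

lemma shape_lessThan:
  "simple_graph {..<k} E \<Longrightarrow> shape {..<k} E = (k, iso_rel k `` {E})"
  by (auto simp: shape_def iso_rel_def)

lemma shape_in_tree_shapes:
  assumes "tree V E"
  shows "shape V E \<in> tree_shapes"
proof -
  have G: "simple_graph V E"
    using assms by (simp add: tree_def forest_def)
  obtain F where F: "simple_graph {..<card V} F" "graph_iso V E {..<card V} F"
    using ex_graph_iso_lessThan[OF G] by blast
  have "shape V E = (card V, iso_rel (card V) `` {F})"
    using shape_eq_iff[OF G F(1)] F shape_lessThan[OF F(1)] by simp
  moreover have "tree {..<card V} F"
    using tree_iso[OF assms F(2)] .
  ultimately show ?thesis
    by (auto simp: tree_shapes_def intro: quotientI)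
qed

lemma tree_shapes_cases:
  assumes "x \<in> tree_shapes"
  obtains E where "tree {..<fst x} E" and "shape {..<fst x} E = x"
proof -
  obtain E where E: "tree {..<fst x} E" "snd x = iso_rel (fst x) `` {E}"
    using assms by (auto simp: tree_shapes_def elim!: quotientE)
  then have "shape {..<fst x} E = x"
    by (simp add: shape_lessThan tree_def forest_def prod_eq_iff)
  with E(1) show ?thesis
    by (rule that)
qed

definition component_shapes :: "'a set \<Rightarrow> 'a set set \<Rightarrow> (nat \<times> nat set set set) multiset" where
  "component_shapes V E = image_mset (\<lambda>C. shape C (E \<inter> Pow C)) (mset_set (components V E))"

lemma component_shapes_empty: "component_shapes {} E = {#}"
  by (simp add: component_shapes_def components_empty)

lemma component_shapes_disjoint_Un:
  assumes G: "simple_graph V E" "simple_graph W F" and W: "connected_graph W F"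
    and disj: "V \<inter> W = {}"
  shows "component_shapes (V \<union> W) (E \<union> F) = add_mset (shape W F) (component_shapes V E)"
proof -
  let ?s = "\<lambda>C. shape C ((E \<union> F) \<inter> Pow C)"
  have fin: "finite (components V E)"
    using G by (intro finite_components) (simp add: simple_graph_def)
  have "W \<notin> components V E"
    using W disj by (auto simp: components_def connected_graph_def)
  then have "component_shapes (V \<union> W) (E \<union> F)
      = add_mset (?s W) (image_mset ?s (mset_set (components V E)))"
    unfolding component_shapes_def components_disjoint_Un[OF assms] using fin
    by (simp only: mset_set.insert not_False_eq_True image_mset_add_mset)
  also have "(E \<union> F) \<inter> Pow W = F"
  proof -
    have "F \<inter> Pow W = F"
      using G(2) by (auto simp: simple_graph_def)
    then show ?thesis
      using disjoint_Un_restrict[OF G(2,1), of W] disj by (simp add: Un_commute Int_commute)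
  qed
  also have "image_mset ?s (mset_set (components V E)) = component_shapes V E"
    unfolding component_shapes_def
  proof (rule image_mset_cong)
    fix C assume "C \<in># mset_set (components V E)"
    then have "C \<subseteq> V"
      using fin by (simp add: components_def)
    then show "shape C ((E \<union> F) \<inter> Pow C) = shape C (E \<inter> Pow C)"
      using disjoint_Un_restrict[OF G disj] by simp
  qed
  finally show ?thesis .
qed

lemma set_component_shapes:
  assumes "forest V E"
  shows "set_mset (component_shapes V E) \<subseteq> tree_shapes"
  using assms
proof (induction rule: forest_induct)
  case (add_tree V E W F)
  then have "component_shapes (V \<union> W) (E \<union> F) = add_mset (shape W F) (component_shapes V E)"
    by (intro component_shapes_disjoint_Un) (auto simp: tree_def forest_def)
  then show ?case
    using add_tree shape_in_tree_shapes[of W F] by simp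
qed (simp add: component_shapes_empty)

lemma sum_component_shapes:
  assumes "forest V E"
  shows "(\<Sum>x\<in>#component_shapes V E. fst x) = card V"
  using assms
proof (induction rule: forest_induct)
  case (add_tree V E W F)
  then have "component_shapes (V \<union> W) (E \<union> F) = add_mset (shape W F) (component_shapes V E)"
    by (intro component_shapes_disjoint_Un) (auto simp: tree_def forest_def)
  moreover have "card (V \<union> W) = card V + card W"
    using add_tree by (intro card_Un_disjoint) (auto simp: tree_def forest_def simple_graph_def)
  ultimately show ?case
    using add_tree by (simp add: shape_def)
qed (simp add: component_shapes_empty)

text \<open>An isomorphism carries a decomposition of the first forest into a smaller forest and a tree to
  such a decomposition of the second one.\<close>
lemma component_shapes_iso:
  assumes "forest V E" and "graph_iso V E V' E'"
  shows "component_shapes V E = component_shapes V' E'"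
  using assms
proof (induction arbitrary: V' E' rule: forest_induct)
  case empty
  then show ?case
    by (auto simp: graph_iso_def bij_betw_def component_shapes_empty)
next
  case (add_tree V E W F)
  have G: "simple_graph V E" "simple_graph W F" and W: "connected_graph W F"
    using add_tree by (auto simp: tree_def forest_def)
  obtain f where f: "bij_betw f (V \<union> W) V'" "E' = (\<lambda>e. f ` e) ` (E \<union> F)"
    using add_tree.prems by (auto simp: graph_iso_def)
  let ?f = "\<lambda>E. (\<lambda>e. f ` e) ` E"
  have inj: "inj_on f (V \<union> W)" and V': "V' = f ` V \<union> f ` W"
    using f by (auto simp: bij_betw_def)
  have iso: "graph_iso V E (f ` V) (?f E)" "graph_iso W F (f ` W) (?f F)"
    by (rule graph_iso_image, rule inj_on_subset[OF inj], blast)+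
  have "component_shapes V' E' = component_shapes (f ` V \<union> f ` W) (?f E \<union> ?f F)"
    by (simp add: V' f(2) image_Un)
  also have "\<dots> = add_mset (shape (f ` W) (?f F)) (component_shapes (f ` V) (?f E))"
  proof (rule component_shapes_disjoint_Un)
    show "f ` V \<inter> f ` W = {}"
      using inj add_tree.hyps by (auto simp: inj_on_def)
  qed (use simple_graph_iso connected_graph_iso iso G W in blast)+
  also have "shape (f ` W) (?f F) = shape W F"
    using shape_eq_iff[OF G(2)] simple_graph_iso[OF G(2) iso(2)] iso(2) by metis
  also have "component_shapes (f ` V) (?f E) = component_shapes V E"
    using add_tree.IH[OF iso(1)] by simp
  also have "add_mset (shape W F) \<dots> = component_shapes (V \<union> W) (E \<union> F)"
    using component_shapes_disjoint_Un[OF G W] add_tree.hyps by simp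
  finally show ?case by simp
qed

text \<open>Conversely, a tree removed from the first forest has the shape of some component of the
  second one. Isomorphisms of these two trees and of the remaining forests combine to an
  isomorphism of the whole.\<close>
lemma iso_component_shapes:
  assumes "forest V E" and "forest V' E'" and "component_shapes V E = component_shapes V' E'"
  shows "graph_iso V E V' E'"
  using assms
proof (induction arbitrary: V' E' rule: forest_induct)
  case empty
  have G': "simple_graph V' E'"
    using empty by (simp add: forest_def)
  then have "finite (components V' E')"
    by (intro finite_components) (simp add: simple_graph_def)
  then have "components V' E' = {}"
    using empty by (simp add: component_shapes_def components_empty mset_set_empty_iff)
  then have "V' = {}"
    using ex_component[OF G'] by blast
  then have "E' = {}"
    using G' by (auto simp: simple_graph_def)
  then show ?case
    using \<open>V' = {}\<close> by (simp add: graph_iso_def bij_betw_def)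
next
  case (add_tree V E W F)
  have G: "simple_graph V E" "simple_graph W F" and W: "connected_graph W F"
    using add_tree by (auto simp: tree_def forest_def)
  have G': "simple_graph V' E'"
    using add_tree by (simp add: forest_def)
  have eq: "component_shapes V' E' = add_mset (shape W F) (component_shapes V E)"
    using component_shapes_disjoint_Un[OF G W] add_tree by simp
  then have "shape W F \<in># component_shapes V' E'" by simp
  then obtain C where C: "C \<in> components V' E'" and shape: "shape W F = shape C (E' \<inter> Pow C)"
    using finite_components[of V' E'] G' by (auto simp: component_shapes_def simple_graph_def)
  let ?U = "V' - C" and ?D = "E' \<inter> Pow (V' - C)"
  have T: "tree C (E' \<inter> Pow C)"
    using tree_component[OF add_tree.prems(1) C] .
  have U: "forest ?U ?D"
    using forest_subgraph[OF add_tree.prems(1)] by blast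
  have "component_shapes V' E' = add_mset (shape W F) (component_shapes ?U ?D)"
    using component_shapes_disjoint_Un[of ?U ?D C "E' \<inter> Pow C"] T U
      component_split[OF G' C] shape by (auto simp: tree_def forest_def)
  then have "graph_iso V E ?U ?D"
    using add_tree.IH[OF U] eq by simp
  moreover have "graph_iso W F C (E' \<inter> Pow C)"
    using shape shape_eq_iff[OF G(2), of C "E' \<inter> Pow C"] T by (simp add: tree_def forest_def)
  ultimately have "graph_iso (V \<union> W) (E \<union> F) (?U \<union> C) (?D \<union> (E' \<inter> Pow C))"
    using G add_tree.hyps by (intro graph_iso_Un) auto
  then show ?case
    using component_split[OF G' C] by simp
qed

text \<open>Representatives of the prescribed trees are placed next to each other on consecutive intervals
  of numbers.\<close>
lemma ex_forest_component_shapes: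
  assumes "set_mset M \<subseteq> tree_shapes"
  shows "\<exists>E. forest {..<\<Sum>x\<in>#M. fst x} E \<and> component_shapes {..<\<Sum>x\<in>#M. fst x} E = M"
  using assms
proof (induction M)
  case empty
  have "forest {} ({} :: nat set set)"
    by (auto simp: forest_def simple_graph_def graph_cycle_def graph_walk_def)
  then show ?case
    using component_shapes_empty by auto
next
  case (add x M)
  let ?m = "\<Sum>x\<in>#M. fst x" and ?k = "fst x"
  obtain E where E: "forest {..<?m} E" "component_shapes {..<?m} E = M"
    using add by auto
  obtain F where F: "tree {..<?k} F" "shape {..<?k} F = x"
    using add.prems tree_shapes_cases[of x] by auto
  let ?W = "(\<lambda>i. ?m + i) ` {..<?k}" and ?F = "(\<lambda>e. (\<lambda>i. ?m + i) ` e) ` F"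
  have iso: "graph_iso {..<?k} F ?W ?F"
    unfolding graph_iso_def by (intro exI[of _ "\<lambda>i. ?m + i"]) (auto simp: bij_betw_def)
  then have T: "tree ?W ?F"
    using tree_iso[OF F(1)] by blast
  then have "shape ?W ?F = x"
    using shape_eq_iff[of "{..<?k}" F ?W ?F] iso F by (auto simp: tree_def forest_def)
  moreover have disj: "{..<?m} \<inter> ?W = {}"
    by auto
  ultimately have "component_shapes ({..<?m} \<union> ?W) (E \<union> ?F) = add_mset x M"
    using component_shapes_disjoint_Un[of "{..<?m}" E ?W ?F] E T by (auto simp: tree_def forest_def)
  moreover have "forest ({..<?m} \<union> ?W) (E \<union> ?F)"
    using forest_disjoint_Un[OF E(1) _ disj] T by (simp add: tree_def)
  moreover have "{..<?m} \<union> ?W = {..<?k + ?m}"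
  proof -
    have "j \<in> ?W" if "\<not> j < ?m" "j < ?k + ?m" for j
      using that by (intro image_eqI[of _ _ "j - ?m"]) auto
    then show ?thesis by auto
  qed
  ultimately show ?case
    by (intro exI[of _ "E \<union> ?F"]) simp
qed

text \<open>The classes of an equivalence relation are counted by any complete invariant.\<close>
lemma card_quotient_eq_card_image:
  assumes "A \<subseteq> B" and "equiv B r"
    and inv: "\<And>x y. x \<in> A \<Longrightarrow> y \<in> A \<Longrightarrow> (x, y) \<in> r \<longleftrightarrow> \<phi> x = \<phi> y"
  shows "card (A // r) = card (\<phi> ` A)"
proof -
  define g where "g m = r `` {SOME x. x \<in> A \<and> \<phi> x = m}" for m
  have g: "g (\<phi> x) = r `` {x}" if "x \<in> A" for x
  proof -
    let ?y = "SOME y. y \<in> A \<and> \<phi> y = \<phi> x"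
    have "?y \<in> A \<and> \<phi> ?y = \<phi> x"
      by (rule someI[of _ x]) (use that in simp)
    then have "(?y, x) \<in> r"
      using inv that by blast
    then show ?thesis
      unfolding g_def using assms(2) equiv_class_eq by metis
  qed
  have "inj_on g (\<phi> ` A)"
  proof (rule inj_onI)
    fix m m' assume "m \<in> \<phi> ` A" "m' \<in> \<phi> ` A" and eq: "g m = g m'"
    then obtain x y where xy: "x \<in> A" "y \<in> A" "m = \<phi> x" "m' = \<phi> y" by blast
    then have "(x, y) \<in> r"
      using eq g assms(1,2) eq_equiv_class_iff[of B r x y] by auto
    then show "m = m'"
      using inv xy by blast
  qed
  moreover have "g ` \<phi> ` A = A // r"
    using g by (auto simp: quotient_def image_image)
  ultimately show ?thesis
    using card_image by metis
qed

text \<open>The multiset of the shapes of its components determines a forest up to isomorphism, and all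
  multisets of shapes of trees occur.\<close>
theorem num_unlabeled_forests_eq:
  "num_unlabeled_forests n = card {M. set_mset M \<subseteq> tree_shapes \<and> (\<Sum>x\<in>#M. fst x) = n}"
proof -
  let ?A = "{E. forest {..<n} E}"
  have "num_unlabeled_forests n = card (component_shapes {..<n} ` ?A)"
    unfolding num_unlabeled_forests_def
  proof (rule card_quotient_eq_card_image[OF _ equiv_iso_rel])
    show "?A \<subseteq> {E. simple_graph {..<n} E}"
      by (auto simp: forest_def)
    fix E F assume "E \<in> ?A" "F \<in> ?A"
    then show "(E, F) \<in> iso_rel n \<longleftrightarrow> component_shapes {..<n} E = component_shapes {..<n} F"
      using component_shapes_iso[of "{..<n}" E "{..<n}" F]
        iso_component_shapes[of "{..<n}" E "{..<n}" F]
      by (auto simp: iso_rel_def forest_def)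
  qed
  also have "component_shapes {..<n} ` ?A
      = {M. set_mset M \<subseteq> tree_shapes \<and> (\<Sum>x\<in>#M. fst x) = n}"
  proof (intro equalityI subsetI)
    fix M assume "M \<in> component_shapes {..<n} ` ?A"
    then obtain E where "forest {..<n} E" "M = component_shapes {..<n} E" by blast
    then show "M \<in> {M. set_mset M \<subseteq> tree_shapes \<and> (\<Sum>x\<in>#M. fst x) = n}"
      using set_component_shapes sum_component_shapes by fastforce
  next
    fix M assume "M \<in> {M. set_mset M \<subseteq> tree_shapes \<and> (\<Sum>x\<in>#M. fst x) = n}"
    then show "M \<in> component_shapes {..<n} ` ?A"
      using ex_forest_component_shapes[of M] by (auto intro!: image_eqI[of M])
  qed
  finally show ?thesis .
qed

lemma tree_shapes_fibre:
  "{x \<in> tree_shapes. fst x = k} = {k} \<times> ({E. tree {..<k} E} // iso_rel k)"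
  by (auto simp: tree_shapes_def)

lemma card_tree_shapes_fibre: "card {x \<in> tree_shapes. fst x = k} = num_unlabeled_trees k"
  by (simp add: tree_shapes_fibre num_unlabeled_trees_def card_cartesian_product)

lemma finite_tree_shapes_fibre: "finite {x \<in> tree_shapes. fst x = k}"
proof -
  have "{E. tree {..<k} E} \<subseteq> Pow (Pow {..<k})"
    by (auto simp: tree_def forest_def simple_graph_def)
  then have "finite {E. tree {..<k} E}"
    by (rule finite_subset) simp
  then have "finite ({E. tree {..<k} E} // iso_rel k)"
    by (simp add: quotient_def)
  then show ?thesis
    by (simp add: tree_shapes_fibre)
qed

lemma tree_shapes_pos: "x \<in> tree_shapes \<Longrightarrow> fst x > 0"
  by (auto simp: tree_shapes_def tree_def connected_graph_def elim!: quotientE)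

section \<open>Multisets of prescribed total weight\<close>

definition weighted_msets :: "('a \<Rightarrow> nat) \<Rightarrow> 'a set \<Rightarrow> nat \<Rightarrow> 'a multiset set" where
  "weighted_msets s A n = {M. set_mset M \<subseteq> A \<and> (\<Sum>x\<in>#M. s x) = n}"

lemma weight_le_sum_mset: "x \<in># M \<Longrightarrow> s x \<le> (\<Sum>x\<in>#M. s x)" for s :: "'a \<Rightarrow> nat"
  by (auto dest!: multi_member_split)

lemma size_le_sum_mset:
  fixes s :: "'a \<Rightarrow> nat"
  assumes "\<And>x. x \<in># M \<Longrightarrow> s x > 0"
  shows "size M \<le> (\<Sum>x\<in>#M. s x)"
  using assms
proof (induction M)
  case (add x M)
  then have "0 < s x" "size M \<le> (\<Sum>x\<in>#M. s x)" by auto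
  then show ?case by simp
qed simp

lemma sum_mset_eq_sum_count:
  fixes s :: "'a \<Rightarrow> nat"
  assumes "finite B" and "set_mset M \<subseteq> B"
  shows "(\<Sum>x\<in>#M. s x) = (\<Sum>x\<in>B. s x * count M x)"
  using assms(2)
proof (induction M)
  case (add y M)
  have "(\<Sum>x\<in>B. s x * count (add_mset y M) x) = (\<Sum>x\<in>B. s x * count M x + (if x = y then s x else 0))"
    by (rule sum.cong) auto
  also have "\<dots> = (\<Sum>x\<in>B. s x * count M x) + s y"
    using add.prems assms(1) by (simp add: sum.distrib)
  finally show ?case
    using add by simp
qed simp

lemma finite_weight_le:
  fixes s :: "'a \<Rightarrow> nat"
  assumes "\<And>k. finite {x \<in> A. s x = k}"
  shows "finite {x \<in> A. s x \<le> n}"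
proof -
  have "{x \<in> A. s x \<le> n} = (\<Union>k\<le>n. {x \<in> A. s x = k})" by auto
  then show ?thesis
    using assms by simp
qed

lemma finite_weighted_msets:
  assumes "\<And>x. x \<in> A \<Longrightarrow> s x > 0" and "\<And>k. finite {x \<in> A. s x = k}"
  shows "finite (weighted_msets s A n)"
proof (rule finite_subset)
  show "weighted_msets s A n \<subseteq> (\<Union>m\<le>n. multisets_of_size {x \<in> A. s x \<le> n} m)"
  proof
    fix M assume M: "M \<in> weighted_msets s A n"
    then have "size M \<le> n"
      using size_le_sum_mset[of M s] assms(1) by (auto simp: weighted_msets_def)
    moreover have "set_mset M \<subseteq> {x \<in> A. s x \<le> n}"
      using M weight_le_sum_mset[of _ M s] by (auto simp: weighted_msets_def)
    ultimately show "M \<in> (\<Union>m\<le>n. multisets_of_size {x \<in> A. s x \<le> n} m)"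
      by (auto simp: multisets_of_size_def)
  qed
  show "finite (\<Union>m\<le>n. multisets_of_size {x \<in> A. s x \<le> n} m)"
    using finite_weight_le[of A s n] assms(2) by auto
qed

lemma card_weighted_msets_count_ge:
  assumes "x \<in> A"
  shows "card {M \<in> weighted_msets s A n. j \<le> count M x}
    = (if j * s x \<le> n then card (weighted_msets s A (n - j * s x)) else 0)"
proof (cases "j * s x \<le> n")
  case True
  let ?f = "\<lambda>M. M + replicate_mset j x"
  have "{M \<in> weighted_msets s A n. j \<le> count M x} = ?f ` weighted_msets s A (n - j * s x)"
  proof (intro equalityI subsetI)
    fix M assume M: "M \<in> {M \<in> weighted_msets s A n. j \<le> count M x}"
    then have sub: "replicate_mset j x \<subseteq># M"
      by (simp add: count_le_replicate_mset_subset_eq)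
    then obtain N where N: "M = ?f N"
      by (metis subset_mset.diff_add)
    then have "N \<in> weighted_msets s A (n - j * s x)"
      using M by (auto simp: weighted_msets_def image_replicate_mset)
    then show "M \<in> ?f ` weighted_msets s A (n - j * s x)"
      using N by blast
  next
    fix M assume "M \<in> ?f ` weighted_msets s A (n - j * s x)"
    then show "M \<in> {M \<in> weighted_msets s A n. j \<le> count M x}"
      using True assms by (auto simp: weighted_msets_def image_replicate_mset split: if_splits)
  qed
  moreover have "inj_on ?f (weighted_msets s A (n - j * s x))"
    by (rule inj_onI) simp
  ultimately show ?thesis
    using True by (simp add: card_image)
next
  case False
  have "{M \<in> weighted_msets s A n. j \<le> count M x} = {}"
  proof (safe; simp)
    fix M assume M: "M \<in> weighted_msets s A n" and "j \<le> count M x"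
    then have "replicate_mset j x \<subseteq># M"
      by (simp add: count_le_replicate_mset_subset_eq)
    then obtain N where "M = N + replicate_mset j x"
      by (metis subset_mset.diff_add)
    then have "j * s x \<le> n"
      using M by (auto simp: weighted_msets_def image_replicate_mset)
    then show False
      using False by simp
  qed
  then show ?thesis
    using False by (simp only: card.empty if_False)
qed

text \<open>Both sides count the total weight of all multisets of weight \<open>n\<close>. An element \<open>x\<close> contributes
  \<open>s x\<close> once for every pair of a multiset and a positive \<open>j\<close> that does not exceed the multiplicity
  of \<open>x\<close>, and taking out \<open>j\<close> copies of \<open>x\<close> leaves an arbitrary multiset of weight \<open>n - j * s x\<close>.\<close>
lemma weighted_msets_recurrence:
  assumes pos: "\<And>x. x \<in> A \<Longrightarrow> s x > 0" and fin: "\<And>k. finite {x \<in> A. s x = k}"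
  shows "n * card (weighted_msets s A n)
    = (\<Sum>k\<le>n. (\<Sum>d | d dvd k. d * card {x \<in> A. s x = d}) * card (weighted_msets s A (n - k)))"
proof -
  let ?W = "weighted_msets s A"
  let ?B = "{x \<in> A. s x \<le> n}"
  have B: "finite ?B"
    using fin by (rule finite_weight_le)
  have W: "finite (?W n)"
    using assms by (rule finite_weighted_msets)
  have "n * card (?W n) = (\<Sum>M\<in>?W n. \<Sum>x\<in>#M. s x)"
    by (simp add: weighted_msets_def mult.commute)
  also have "\<dots> = (\<Sum>M\<in>?W n. \<Sum>x\<in>?B. s x * count M x)"
  proof (rule sum.cong[OF refl])
    fix M assume "M \<in> ?W n"
    then have "set_mset M \<subseteq> ?B"
      using weight_le_sum_mset[of _ M s] by (auto simp: weighted_msets_def)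
    then show "(\<Sum>x\<in>#M. s x) = (\<Sum>x\<in>?B. s x * count M x)"
      by (rule sum_mset_eq_sum_count[OF B])
  qed
  also have "\<dots> = (\<Sum>x\<in>?B. s x * (\<Sum>M\<in>?W n. count M x))"
    by (subst sum.swap) (simp add: sum_distrib_left)
  also have "\<dots> = (\<Sum>x\<in>?B. \<Sum>k | k \<in> {1..n} \<and> s x dvd k. s x * card (?W (n - k)))"
  proof (rule sum.cong[OF refl])
    fix x assume x: "x \<in> ?B"
    then have sx: "s x > 0" using pos by simp
    have "(\<Sum>M\<in>?W n. count M x) = (\<Sum>M\<in>?W n. \<Sum>j\<in>{1..n}. of_bool (j \<le> count M x))"
    proof (rule sum.cong[OF refl])
      fix M assume M: "M \<in> ?W n"
      have "count M x \<le> size M"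
        by (simp add: count_le_size)
      also have "size M \<le> n"
        using size_le_sum_mset[of M s] M pos by (auto simp: weighted_msets_def)
      finally have "{1..n} \<inter> {j. j \<le> count M x} = {1..count M x}" by auto
      then show "count M x = (\<Sum>j\<in>{1..n}. of_bool (j \<le> count M x))"
        by (simp add: sum_of_bool_eq)
    qed
    also have "\<dots> = (\<Sum>j\<in>{1..n}. card {M \<in> ?W n. j \<le> count M x})"
      using W by (subst sum.swap) (simp add: sum_of_bool_eq Int_def)
    also have "\<dots> = (\<Sum>j\<in>{1..n}. if j * s x \<le> n then card (?W (n - j * s x)) else 0)"
      using x by (simp only: card_weighted_msets_count_ge mem_Collect_eq)
    also have "\<dots> = (\<Sum>j | j \<in> {1..n} \<and> j * s x \<le> n. card (?W (n - j * s x)))"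
      by (rule sum.inter_filter[symmetric]) simp
    also have "\<dots> = (\<Sum>k | k \<in> {1..n} \<and> s x dvd k. card (?W (n - k)))"
    proof (rule sum.reindex_bij_witness[where i = "\<lambda>k. k div s x" and j = "\<lambda>j. j * s x"])
      fix k assume "k \<in> {k \<in> {1..n}. s x dvd k}"
      then have k: "k \<in> {1..n}" "k div s x * s x = k"
        by auto
      then have "k div s x \<noteq> 0"
        by (metis atLeastAtMost_iff mult_0 not_one_le_zero)
      moreover have "k div s x \<le> n"
        using k(1) div_le_dividend[of k "s x"] by (simp del: div_le_dividend)
      ultimately show "k div s x \<in> {j \<in> {1..n}. j * s x \<le> n}"
        using k by simp
    qed (use sx in \<open>auto simp: Suc_le_eq\<close>)
    finally show "s x * (\<Sum>M\<in>?W n. count M x)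
        = (\<Sum>k | k \<in> {1..n} \<and> s x dvd k. s x * card (?W (n - k)))"
      by (simp add: sum_distrib_left)
  qed
  also have "\<dots> = (\<Sum>k\<in>{1..n}. \<Sum>x | x \<in> ?B \<and> s x dvd k. s x * card (?W (n - k)))"
    using B by (intro sum.swap_restrict) auto
  also have "\<dots> = (\<Sum>k\<in>{1..n}. (\<Sum>d | d dvd k. d * card {x \<in> A. s x = d}) * card (?W (n - k)))"
  proof (rule sum.cong[OF refl])
    fix k assume k: "k \<in> {1..n}"
    have "(\<Sum>x | x \<in> ?B \<and> s x dvd k. s x)
        = (\<Sum>d | d dvd k. \<Sum>x | x \<in> {x \<in> ?B. s x dvd k} \<and> s x = d. s x)"
      using k by (intro sum.group[symmetric] finite_subset[OF _ B]) auto
    also have "\<dots> = (\<Sum>d | d dvd k. d * card {x \<in> A. s x = d})"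
    proof (rule sum.cong[OF refl])
      fix d assume "d \<in> {d. d dvd k}"
      then have "{x \<in> {x \<in> ?B. s x dvd k}. s x = d} = {x \<in> A. s x = d}"
        using k by (auto dest: dvd_imp_le)
      then show "(\<Sum>x | x \<in> {x \<in> ?B. s x dvd k} \<and> s x = d. s x) = d * card {x \<in> A. s x = d}"
        by simp
    qed
    finally show "(\<Sum>x | x \<in> ?B \<and> s x dvd k. s x * card (?W (n - k)))
        = (\<Sum>d | d dvd k. d * card {x \<in> A. s x = d}) * card (?W (n - k))"
      by (simp flip: sum_distrib_right)
  qed
  \<comment> \<open>The term for \<open>k = 0\<close> vanishes: every \<open>d\<close> divides \<open>0\<close>, and a sum over an infinite set is \<open>0\<close>.\<close>
  also have "\<dots> = (\<Sum>k\<le>n. (\<Sum>d | d dvd k. d * card {x \<in> A. s x = d}) * card (?W (n - k)))"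
    by (rule sum.mono_neutral_left) (auto simp: not_le)
  finally show ?thesis .
qed

section \<open>The generating function as a product\<close>

text \<open>The recurrence expresses the partial sums of \<open>u\<close> by those of \<open>v\<close> and by \<open>q\<close> times shorter
  partial sums of \<open>u\<close>. As \<open>q < 1\<close>, the partial sums of the nonnegative \<open>u\<close> are bounded, and the
  limit can be computed from the shifted series.\<close>
lemma sums_geometric_recurrence:
  fixes u v :: "nat \<Rightarrow> real"
  assumes v: "v sums b" and q: "0 \<le> q" "q < 1" and u: "\<And>n. u n \<ge> 0"
    and rec: "\<And>n. u n = v n + (if m \<le> n then q * u (n - m) else 0)"
  shows "u sums (b / (1 - q))"
proof -
  let ?g = "\<lambda>n. if m \<le> n then q * u (n - m) else 0"
  have v0: "v n \<ge> 0" if "n < m" for n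
    using u[of n] rec[of n] that by simp
  have g: "(\<Sum>n<N. ?g n) \<le> q * (\<Sum>n<N. u n)" for N
  proof -
    have "(\<Sum>n<N. ?g n) = (\<Sum>n\<in>{m..<N}. q * u (n - m))"
      by (rule sum.mono_neutral_cong_right) auto
    also have "\<dots> = (\<Sum>n<N - m. q * u n)"
      by (rule sum.reindex_bij_witness[where i = "\<lambda>n. n + m" and j = "\<lambda>n. n - m"]) auto
    also have "\<dots> \<le> (\<Sum>n<N. q * u n)"
      using u q by (intro sum_mono2) auto
    finally show ?thesis
      by (simp add: sum_distrib_left)
  qed
  obtain K where K: "\<And>N. (\<Sum>n<N. v n) \<le> K"
  proof -
    have "Bseq (\<lambda>N. \<Sum>n<N. v n)"
      using v convergent_imp_Bseq unfolding sums_def convergent_def by blast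
    then obtain K where "\<And>N. norm (\<Sum>n<N. v n) \<le> K"
      by (auto simp: Bseq_def)
    then show ?thesis
      using that[of K] by (metis abs_le_D1 real_norm_def)
  qed
  have bound: "(\<Sum>n<N. u n) \<le> K / (1 - q)" for N
  proof -
    have "(\<Sum>n<N. u n) = (\<Sum>n<N. v n) + (\<Sum>n<N. ?g n)"
      unfolding sum.distrib[symmetric] by (rule sum.cong[OF refl rec])
    then have "(1 - q) * (\<Sum>n<N. u n) \<le> K"
      using g[of N] K[of N] by (simp add: algebra_simps)
    then show ?thesis
      using q by (simp add: field_simps)
  qed
  have "summable u"
    by (rule summableI_nonneg_bounded[OF u bound])
  then have "u sums suminf u"
    by (rule summable_sums)
  then have "(\<lambda>n. ?g (n + m)) sums (q * suminf u)"
    by (simp add: sums_mult)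
  then have "?g sums (q * suminf u)"
    by (subst (asm) sums_zero_iff_shift) auto
  then have "(\<lambda>n. v n + ?g n) sums (b + q * suminf u)"
    by (rule sums_add[OF v])
  then have "u sums (b + q * suminf u)"
    using rec by (metis (no_types, lifting) sums_cong)
  then have "suminf u = b + q * suminf u"
    using \<open>u sums suminf u\<close> sums_unique2 by blast
  then have "suminf u = b / (1 - q)"
    using q by (simp add: field_simps)
  then show ?thesis
    using \<open>u sums suminf u\<close> by simp
qed

text \<open>A multiset over \<open>insert x A\<close> either avoids \<open>x\<close> or arises from a lighter multiset over
  \<open>insert x A\<close> by adding \<open>x\<close>. This makes the two generating functions differ by the factor
  \<open>1 / (1 - z ^ s x)\<close>.\<close>
lemma weighted_msets_generating_function:
  fixes z :: real
  assumes "finite A" and "\<And>x. x \<in> A \<Longrightarrow> s x > 0" and z: "0 < z" "z < 1"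
  shows "(\<lambda>n. real (card (weighted_msets s A n)) * z ^ n) sums (\<Prod>x\<in>A. 1 / (1 - z ^ s x))"
  using assms(1,2)
proof (induction A rule: finite_induct)
  case empty
  have "(\<Sum>x\<in>#M. s x) = 0" if "set_mset M \<subseteq> {}" for M
    using that by simp
  then have "weighted_msets s {} n = (if n = 0 then {{#}} else {})" for n
    by (auto simp: weighted_msets_def)
  then have "(\<lambda>n. real (card (weighted_msets s {} n)) * z ^ n) = (\<lambda>n. if n = 0 then 1 else 0)"
    by auto
  then show ?case
    using sums_single[of 0 "\<lambda>_. 1 :: real"] by simp
next
  case (insert x A)
  let ?W = "weighted_msets s"
  have fin: "finite (?W B n)" if sub: "B \<subseteq> insert x A" for B n
  proof (rule finite_weighted_msets)
    have "finite B"
      using sub insert.hyps finite_subset by blast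
    then show "finite {x \<in> B. s x = k}" for k by simp
    show "s x > 0" if "x \<in> B" for x
      using that sub insert.prems by blast
  qed
  have split: "?W (insert x A) n = ?W A n \<union> {M \<in> ?W (insert x A) n. 1 \<le> count M x}" for n
    by (auto simp: weighted_msets_def Suc_le_eq)
  have "card (?W (insert x A) n) = card (?W A n) + card {M \<in> ?W (insert x A) n. 1 \<le> count M x}" for n
  proof (subst split, rule card_Un_disjoint)
    show "?W A n \<inter> {M \<in> ?W (insert x A) n. 1 \<le> count M x} = {}"
      using insert.hyps by (auto simp: weighted_msets_def Suc_le_eq)
    show "finite {M \<in> ?W (insert x A) n. 1 \<le> count M x}"
      by (rule finite_subset[OF _ fin[of "insert x A" n]]) auto
  qed (use fin in auto)
  then have rec: "card (?W (insert x A) n)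
      = card (?W A n) + (if s x \<le> n then card (?W (insert x A) (n - s x)) else 0)" for n
    using card_weighted_msets_count_ge[of x "insert x A" s n 1] by simp
  have "(\<lambda>n. real (card (?W (insert x A) n)) * z ^ n) sums ((\<Prod>x\<in>A. 1 / (1 - z ^ s x)) / (1 - z ^ s x))"
  proof (rule sums_geometric_recurrence[where m = "s x"])
    show "(\<lambda>n. real (card (?W A n)) * z ^ n) sums (\<Prod>x\<in>A. 1 / (1 - z ^ s x))"
      using insert by simp
    show "z ^ s x < 1"
      using insert.prems z by (simp add: power_less_one_iff)
    show "real (card (?W (insert x A) n)) * z ^ n = real (card (?W A n)) * z ^ n
        + (if s x \<le> n then z ^ s x * (real (card (?W (insert x A) (n - s x))) * z ^ (n - s x)) else 0)"
      for n
      by (subst rec) (simp add: algebra_simps flip: power_add)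
  qed (use z in auto)
  then show ?case
    using insert.hyps by (simp add: mult.commute)
qed

text \<open>Multisets over the elements of weight at most \<open>K\<close> exhaust the multisets of weight \<open>n\<close>
  as soon as \<open>n \<le> K\<close>, so the finite products converge to the full generating function.\<close>
lemma weighted_msets_partial_products:
  fixes z :: real
  assumes pos: "\<And>x. x \<in> A \<Longrightarrow> s x > 0" and fin: "\<And>k. finite {x \<in> A. s x = k}"
    and z: "0 < z" "z < 1"
    and sm: "summable (\<lambda>n. real (card (weighted_msets s A n)) * z ^ n)"
  shows "0 < (\<Sum>n. real (card (weighted_msets s A n)) * z ^ n)"
    and "(\<lambda>K. \<Prod>k\<in>{1..K}. (1 - z ^ k) ^ card {x \<in> A. s x = k})
      \<longlonglongrightarrow> 1 / (\<Sum>n. real (card (weighted_msets s A n)) * z ^ n)"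
proof -
  let ?B = "\<lambda>K. {x \<in> A. s x \<le> K}"
  let ?b = "\<lambda>n. real (card (weighted_msets s A n)) * z ^ n"
  let ?a = "\<lambda>n K. real (card (weighted_msets s (?B K) n)) * z ^ n"
  have finB: "finite (?B K)" for K
    using fin by (rule finite_weight_le)
  have finW: "finite (weighted_msets s A n)" for n
    using pos fin by (rule finite_weighted_msets)
  have eq: "(\<Sum>n. ?a n K) = 1 / (\<Prod>k\<in>{1..K}. (1 - z ^ k) ^ card {x \<in> A. s x = k})" for K
  proof -
    have "(\<Sum>n. ?a n K) = (\<Prod>x\<in>?B K. 1 / (1 - z ^ s x))"
      using weighted_msets_generating_function[OF finB, of K s z] pos z
      by (intro sums_unique[symmetric]) auto
    also have "\<dots> = 1 / (\<Prod>x\<in>?B K. 1 - z ^ s x)"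
      by (simp add: prod_dividef)
    also have "(\<Prod>x\<in>?B K. 1 - z ^ s x) = (\<Prod>k\<in>{1..K}. \<Prod>x | x \<in> ?B K \<and> s x = k. 1 - z ^ s x)"
      using pos finB by (intro prod.group[symmetric]) (auto simp: Suc_le_eq)
    also have "\<dots> = (\<Prod>k\<in>{1..K}. (1 - z ^ k) ^ card {x \<in> A. s x = k})"
    proof (rule prod.cong[OF refl])
      fix k assume "k \<in> {1..K}"
      then have "{x. x \<in> ?B K \<and> s x = k} = {x \<in> A. s x = k}" by auto
      then show "(\<Prod>x | x \<in> ?B K \<and> s x = k. 1 - z ^ s x) = (1 - z ^ k) ^ card {x \<in> A. s x = k}"
        by simp
    qed
    finally show ?thesis .
  qed
  have stable: "weighted_msets s (?B K) n = weighted_msets s A n" if "n \<le> K" for n K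
  proof -
    have "s x \<le> K" if "x \<in># M" "(\<Sum>x\<in>#M. s x) = n" for x M
      using weight_le_sum_mset[of x M s] that \<open>n \<le> K\<close> by simp
    then show ?thesis
      unfolding weighted_msets_def by blast
  qed
  have le: "?a n K \<le> ?b n" for n K
    using z finW by (intro mult_right_mono of_nat_mono card_mono) (auto simp: weighted_msets_def)
  have "(\<lambda>K. \<Sum>n. ?a n K) \<longlonglongrightarrow> (\<Sum>n. ?b n)"
  proof (rule tannerys_theorem[THEN conjunct2, THEN conjunct2])
    show "(\<lambda>K. ?a n K) \<longlonglongrightarrow> ?b n" for n
      by (rule tendsto_eventually, rule eventually_sequentiallyI[of n]) (simp add: stable)
    show "\<forall>\<^sub>F (n, K) in at_top \<times>\<^sub>F at_top. norm (?a n K) \<le> ?b n"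
      using le z by (intro always_eventually) auto
  qed (use sm in auto)
  moreover show "0 < (\<Sum>n. ?b n)"
  proof -
    have "weighted_msets s A 0 = {{#}}"
    proof -
      have "M = {#}" if "set_mset M \<subseteq> A" "(\<Sum>x\<in>#M. s x) = 0" for M
        using that pos by (cases M) fastforce+
      then show ?thesis
        by (auto simp: weighted_msets_def)
    qed
    then have "0 < ?b 0" by simp
    then show ?thesis
      using suminf_pos2[OF sm, of 0] z by simp
  qed
  ultimately have "(\<lambda>K. 1 / (\<Sum>n. ?a n K)) \<longlonglongrightarrow> 1 / (\<Sum>n. ?b n)"
    by (intro tendsto_intros) auto
  then show "(\<lambda>K. \<Prod>k\<in>{1..K}. (1 - z ^ k) ^ card {x \<in> A. s x = k}) \<longlonglongrightarrow> 1 / (\<Sum>n. ?b n)"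
    by (simp add: eq)
qed

section \<open>Asymptotics of a convolution recurrence\<close>

lemma powr_subadditive:
  fixes x y p :: real
  assumes "0 \<le> x" "0 \<le> y" and p: "0 \<le> p" "p \<le> 1"
  shows "(x + y) powr p \<le> x powr p + y powr p"
proof (cases "x = 0 \<or> y = 0")
  case False
  then have xy: "x > 0" "y > 0" using assms by auto
  have *: "z powr p = z * z powr (p - 1)" if "z > 0" for z :: real
    using that by (simp add: powr_diff)
  have "(x + y) powr p = x * (x + y) powr (p - 1) + y * (x + y) powr (p - 1)"
    using xy *[of "x + y"] by (simp add: algebra_simps)
  also have "\<dots> \<le> x * x powr (p - 1) + y * y powr (p - 1)"
    using xy p by (intro add_mono mult_left_mono powr_mono2') auto
  finally show ?thesis
    using xy * by simp
qed auto

text \<open>For \<open>2 * j > n\<close> a bound of order \<open>j powr (- p)\<close> on \<open>v j\<close> is one of order \<open>n powr (- p)\<close>, and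
  the factors \<open>u (n - j)\<close> have a bounded sum.\<close>
lemma sum_upper_half_le:
  fixes u v :: "nat \<Rightarrow> real"
  assumes u: "\<And>k. u k \<ge> 0" "summable u" and p: "p \<ge> 0"
    and v: "\<And>j. v j \<ge> 0" "\<And>j. real j powr p * v j \<le> C"
  shows "real n powr p * (\<Sum>j | j \<le> n \<and> n < 2 * j. u (n - j) * v j) \<le> 2 powr p * C * suminf u"
proof -
  have C: "0 \<le> C"
    using v(2)[of 0] by simp
  have "real n powr p * (\<Sum>j | j \<le> n \<and> n < 2 * j. u (n - j) * v j)
      \<le> (\<Sum>j | j \<le> n \<and> n < 2 * j. u (n - j) * (2 powr p * C))"
    unfolding sum_distrib_left
  proof (rule sum_mono)
    fix j assume "j \<in> {j. j \<le> n \<and> n < 2 * j}"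
    then have "real n powr p \<le> (2 * real j) powr p"
      using p by (intro powr_mono2) auto
    then have "real n powr p * v j \<le> 2 powr p * (real j powr p * v j)"
      using v(1)[of j] by (simp add: powr_mult mult.assoc[symmetric] mult_right_mono)
    also have "\<dots> \<le> 2 powr p * C"
      using v(2)[of j] by simp
    finally have "u (n - j) * (real n powr p * v j) \<le> u (n - j) * (2 powr p * C)"
      using u(1) by (rule mult_left_mono)
    then show "real n powr p * (u (n - j) * v j) \<le> u (n - j) * (2 powr p * C)"
      by (simp add: mult_ac)
  qed
  also have "\<dots> = 2 powr p * C * (\<Sum>j | j \<le> n \<and> n < 2 * j. u (n - j))"
    by (simp add: sum_distrib_left mult_ac)
  also have "(\<Sum>j | j \<le> n \<and> n < 2 * j. u (n - j)) = sum u ((\<lambda>j. n - j) ` {j. j \<le> n \<and> n < 2 * j})"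
    by (subst sum.reindex) (auto simp: inj_on_def)
  also have "\<dots> \<le> suminf u"
    using u by (intro sum_le_suminf) auto
  finally show ?thesis
    using C by (simp add: mult_left_mono)
qed

lemma summable_powr_bound:
  fixes u :: "nat \<Rightarrow> real"
  assumes "\<And>n. u n \<ge> 0" and "\<And>n. n > 0 \<Longrightarrow> real n powr p * u n \<le> C" and "p > 1"
  shows "summable u"
proof (rule summable_comparison_test)
  have "norm (u n) \<le> C * real n powr (- p)" if "n \<ge> 1" for n
    using assms(1)[of n] assms(2)[of n] that by (simp add: powr_minus field_simps)
  then show "\<exists>N. \<forall>n\<ge>N. norm (u n) \<le> C * real n powr (- p)"
    by blast
  show "summable (\<lambda>n. C * real n powr (- p))"
    using assms(3) by (intro summable_mult) (simp add: summable_real_powr_iff)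
qed

text \<open>The recurrence bounds \<open>real n * b n\<close> by \<open>suminf w\<close> times the maximum of the earlier values, so
  from \<open>n \<ge> suminf w\<close> on no value exceeds all earlier ones.\<close>
lemma convolution_recurrence_bounded:
  fixes w b :: "nat \<Rightarrow> real"
  assumes w: "\<And>n. w n \<ge> 0" "w 0 = 0" "summable w" and b: "\<And>n. b n \<ge> 0"
    and rec: "\<And>n. real n * b n = (\<Sum>k\<le>n. w k * b (n - k))"
  obtains M where "\<And>n. b n \<le> M"
proof -
  obtain N where N: "suminf w \<le> real N"
    using real_arch_simple by blast
  define M where "M = Max (b ` {..N})"
  have "b n \<le> M" for n
  proof (induction n rule: less_induct)
    case (less n)
    show ?case
    proof (cases "n \<le> N")
      case True
      then show ?thesis
        unfolding M_def by (intro Max_ge) auto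
    next
      case False
      then have n: "n > 0" by simp
      have "b 0 \<le> M"
        using less.IH n by blast
      then have M: "M \<ge> 0"
        using b[of 0] by linarith
      have "real n * b n \<le> (\<Sum>k\<le>n. w k * M)"
        unfolding rec
      proof (rule sum_mono)
        fix k assume "k \<in> {..n}"
        show "w k * b (n - k) \<le> w k * M"
        proof (cases "k = 0")
          case False
          then show ?thesis
            using n less.IH[of "n - k"] w(1) by (intro mult_left_mono) auto
        qed (simp add: w(2))
      qed
      also have "\<dots> = sum w {..n} * M"
        by (rule sum_distrib_right[symmetric])
      also have "\<dots> \<le> real N * M"
        using sum_le_suminf[OF w(3), of "{..n}"] w(1) N M by (intro mult_right_mono) auto
      also have "\<dots> \<le> real n * M"
        using False M by (intro mult_right_mono) auto
      finally show ?thesis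
        using n by simp
    qed
  qed
  then show ?thesis by (rule that)
qed

text \<open>Boundedness of \<open>b\<close> and summability of \<open>w\<close> give \<open>b n = O(1 / n)\<close>, which is just too weak for
  summability. To gain the factor \<open>n powr (1 / 4)\<close>, it is distributed over the two factors of each
  term of the convolution by subadditivity: the sequence \<open>k powr (1 / 4) * w k\<close> is still summable,
  and \<open>n powr (1 / 4) * b n\<close> is bounded by \<open>real n * b n\<close>.\<close>
lemma convolution_recurrence_decay:
  fixes w b :: "nat \<Rightarrow> real"
  assumes w: "\<And>n. w n \<ge> 0" "w 0 = 0" and b: "\<And>n. b n \<ge> 0"
    and rec: "\<And>n. real n * b n = (\<Sum>k\<le>n. w k * b (n - k))"
    and D: "\<And>n. real n powr (3 / 2) * w n \<le> D"
  obtains C where "\<And>n. real n powr (5 / 4) * b n \<le> C"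
proof -
  have sw: "summable w"
    by (rule summable_powr_bound[OF w(1) D]) simp
  define w' where "w' n = real n powr (1 / 4) * w n" for n
  have w': "w' n \<ge> 0" for n
    using w(1) by (simp add: w'_def)
  have sw': "summable w'"
  proof (rule summable_powr_bound[OF w', where p = "5 / 4" and C = D])
    fix n :: nat
    show "real n powr (5 / 4) * w' n \<le> D"
      using D[of n] by (simp add: w'_def mult.assoc[symmetric] flip: powr_add)
  qed simp
  obtain M where M: "\<And>n. b n \<le> M"
    using convolution_recurrence_bounded[OF w sw b rec] by blast
  have M0: "M \<ge> 0"
    using M[of 0] b[of 0] by linarith
  have nb: "real n * b n \<le> suminf w * M" for n
  proof -
    have "real n * b n \<le> (\<Sum>k\<le>n. w k * M)"
      unfolding rec using w(1) M by (intro sum_mono mult_left_mono) auto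
    also have "\<dots> = sum w {..n} * M"
      by (rule sum_distrib_right[symmetric])
    also have "\<dots> \<le> suminf w * M"
      using sum_le_suminf[OF sw, of "{..n}"] w(1) M0 by (intro mult_right_mono) auto
    finally show ?thesis .
  qed
  have nb': "real n powr (1 / 4) * b n \<le> suminf w * M" for n
  proof -
    have "real n powr (1 / 4) \<le> real n"
      using powr_mono[of "1 / 4" 1 "real n"] by (cases "n = 0") auto
    then show ?thesis
      using nb[of n] b[of n] by (meson mult_right_mono order_trans)
  qed
  have "real n powr (5 / 4) * b n \<le> suminf w' * M + suminf w * (suminf w * M)" for n
  proof -
    have "real n powr (5 / 4) * b n = real n powr (1 / 4) * (real n * b n)"
      using powr_mult_base[of "real n" "1 / 4"] by (simp add: mult_ac)
    also have "\<dots> = (\<Sum>k\<le>n. real n powr (1 / 4) * (w k * b (n - k)))"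
      by (simp add: rec sum_distrib_left)
    also have "\<dots> \<le> (\<Sum>k\<le>n. w' k * M + w k * (suminf w * M))"
    proof (rule sum_mono)
      fix k assume "k \<in> {..n}"
      then have "real n powr (1 / 4) \<le> real k powr (1 / 4) + real (n - k) powr (1 / 4)"
        using powr_subadditive[of "real k" "real (n - k)" "1 / 4"] by simp
      then have "real n powr (1 / 4) * (w k * b (n - k))
          \<le> (real k powr (1 / 4) + real (n - k) powr (1 / 4)) * (w k * b (n - k))"
        using w(1) b by (intro mult_right_mono) auto
      also have "\<dots> = w' k * b (n - k) + w k * (real (n - k) powr (1 / 4) * b (n - k))"
        by (simp add: w'_def algebra_simps)
      also have "\<dots> \<le> w' k * M + w k * (suminf w * M)"
        using w' w(1) M nb' by (intro add_mono mult_left_mono) auto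
      finally show "real n powr (1 / 4) * (w k * b (n - k)) \<le> w' k * M + w k * (suminf w * M)" .
    qed
    also have "\<dots> = sum w' {..n} * M + sum w {..n} * (suminf w * M)"
      by (simp add: sum.distrib sum_distrib_right)
    also have "\<dots> \<le> suminf w' * M + suminf w * (suminf w * M)"
      using sum_le_suminf[OF sw, of "{..n}"] sum_le_suminf[OF sw', of "{..n}"] w(1) w' M0
        suminf_nonneg[OF sw] by (intro add_mono mult_right_mono) auto
    finally show ?thesis .
  qed
  then show ?thesis by (rule that)
qed

text \<open>The convolution is cut at \<open>j = n / 2\<close>. The terms \<open>w (n - j) * b j\<close> with small \<open>j\<close> behave like
  \<open>\<beta> * n powr (- 3 / 2) * b j\<close>, and dominated convergence sums them to
  \<open>\<beta> * n powr (- 3 / 2) * suminf b\<close>. The terms with large \<open>j\<close> are negligible as soon as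
  \<open>b j = o(j powr (- 3 / 2))\<close>. The exponent \<open>5 / 4\<close> known for \<open>b\<close> does not reach this, but
  inserting it into the cut sum improves it to \<open>9 / 4\<close>, which does.\<close>
theorem convolution_recurrence_asymptotics:
  fixes w b :: "nat \<Rightarrow> real"
  assumes w: "\<And>n. w n \<ge> 0" "w 0 = 0" and b: "\<And>n. b n \<ge> 0"
    and rec: "\<And>n. real n * b n = (\<Sum>k\<le>n. w k * b (n - k))"
    and lim: "(\<lambda>n. real n powr (3 / 2) * w n) \<longlonglongrightarrow> \<beta>"
  shows "summable b" and "(\<lambda>n. real n powr (5 / 2) * b n) \<longlonglongrightarrow> \<beta> * suminf b"
proof -
  have "Bseq (\<lambda>n. real n powr (3 / 2) * w n)"
    using lim convergent_imp_Bseq convergentI by blast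
  then obtain D where "\<And>n. norm (real n powr (3 / 2) * w n) \<le> D"
    by (auto simp: Bseq_def)
  then have D: "real n powr (3 / 2) * w n \<le> D" for n
    by (metis abs_le_D1 real_norm_def)
  have sw: "summable w"
    by (rule summable_powr_bound[OF w(1) D]) simp
  obtain C where C: "\<And>n. real n powr (5 / 4) * b n \<le> C"
    using convolution_recurrence_decay[OF w b rec D] by blast
  show sb: "summable b"
    by (rule summable_powr_bound[OF b C]) simp
  define low where "low n = (\<Sum>j | 2 * j \<le> n. real n powr (3 / 2) * (w (n - j) * b j))" for n
  define high where "high n = (\<Sum>j | j \<le> n \<and> n < 2 * j. w (n - j) * b j)" for n
  have split: "real n powr (5 / 2) * b n = low n + real n powr (3 / 2) * high n" for n
  proof -
    have "real n powr (5 / 2) * b n = real n powr (3 / 2) * (real n * b n)"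
      using powr_mult_base[of "real n" "3 / 2"] by (simp add: mult_ac)
    also have "real n * b n = (\<Sum>j\<le>n. w (n - j) * b j)"
      unfolding rec
      by (rule sum.reindex_bij_witness[where i = "\<lambda>j. n - j" and j = "\<lambda>j. n - j"]) auto
    also have "{..n} = {j. 2 * j \<le> n} \<union> {j. j \<le> n \<and> n < 2 * j}" by auto
    also have "(\<Sum>j\<in>\<dots>. w (n - j) * b j) = (\<Sum>j | 2 * j \<le> n. w (n - j) * b j) + high n"
      unfolding high_def
      by (rule sum.union_disjoint) (auto intro: finite_subset[of _ "{..n}"])
    finally show ?thesis
      by (simp add: low_def sum_distrib_left algebra_simps)
  qed
  have low_term: "real n powr (3 / 2) * (w (n - j) * b j) \<le> 2 powr (3 / 2) * D * b j"
    if "2 * j \<le> n" for n j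
  proof -
    have "real n powr (3 / 2) \<le> (2 * real (n - j)) powr (3 / 2)"
      using that by (intro powr_mono2) auto
    then have "real n powr (3 / 2) * w (n - j) \<le> (2 * real (n - j)) powr (3 / 2) * w (n - j)"
      using w(1) by (rule mult_right_mono)
    also have "\<dots> = 2 powr (3 / 2) * (real (n - j) powr (3 / 2) * w (n - j))"
      by (simp add: powr_mult)
    also have "\<dots> \<le> 2 powr (3 / 2) * D"
      using D by simp
    finally show ?thesis
      using b[of j] mult_right_mono by (fastforce simp: mult.assoc[symmetric])
  qed
  have low_suminf: "low n = (\<Sum>j. if 2 * j \<le> n then real n powr (3 / 2) * (w (n - j) * b j) else 0)" for n
    unfolding low_def
    by (subst suminf_finite[of "{j. 2 * j \<le> n}"]) (auto intro: finite_subset[of _ "{..n}"])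
  have low: "low \<longlonglongrightarrow> \<beta> * suminf b"
  proof -
    let ?a = "\<lambda>j n. if 2 * j \<le> n then real n powr (3 / 2) * (w (n - j) * b j) else 0"
    have "(\<lambda>n. \<Sum>j. ?a j n) \<longlonglongrightarrow> (\<Sum>j. \<beta> * b j)"
    proof (rule tannerys_theorem[THEN conjunct2, THEN conjunct2])
      show "(\<lambda>n. ?a j n) \<longlonglongrightarrow> \<beta> * b j" for j
      proof -
        have "(\<lambda>n. ((real n + real j) / real n) powr (3 / 2)) \<longlonglongrightarrow> 1"
          by real_asymp
        then have "(\<lambda>n. ((real n + real j) / real n) powr (3 / 2) * (real n powr (3 / 2) * w n)) \<longlonglongrightarrow> 1 * \<beta>"
          using lim by (rule tendsto_mult)
        moreover have "\<forall>\<^sub>F n in sequentially. ((real n + real j) / real n) powr (3 / 2) * (real n powr (3 / 2) * w n)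
            = real (n + j) powr (3 / 2) * w (n + j - j)"
          using eventually_gt_at_top[of 0] by eventually_elim (simp add: powr_divide)
        ultimately have "(\<lambda>n. real (n + j) powr (3 / 2) * w (n + j - j)) \<longlonglongrightarrow> 1 * \<beta>"
          by (rule Lim_transform_eventually)
        then have "(\<lambda>n. real n powr (3 / 2) * w (n - j)) \<longlonglongrightarrow> 1 * \<beta>"
          by (rule LIMSEQ_offset)
        then have "(\<lambda>n. (real n powr (3 / 2) * w (n - j)) * b j) \<longlonglongrightarrow> 1 * \<beta> * b j"
          by (rule tendsto_mult_right)
        moreover have "\<forall>\<^sub>F n in sequentially. (real n powr (3 / 2) * w (n - j)) * b j = ?a j n"
          using eventually_ge_at_top[of "2 * j"] by eventually_elim (simp add: mult.assoc)
        ultimately show ?thesis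
          using Lim_transform_eventually by fastforce
      qed
      have "norm (?a j n) \<le> 2 powr (3 / 2) * D * b j" for j n
      proof -
        have "0 \<le> D"
          using D[of 0] by simp
        then show ?thesis
          using low_term[of j n] w(1)[of "n - j"] b[of j] by (simp add: abs_mult)
      qed
      then show "\<forall>\<^sub>F (j, n) in at_top \<times>\<^sub>F sequentially. norm (?a j n) \<le> 2 powr (3 / 2) * D * b j"
        by (intro always_eventually) auto
      show "summable (\<lambda>j. 2 powr (3 / 2) * D * b j)"
        using sb by (rule summable_mult)
    qed simp
    moreover have "low = (\<lambda>n. \<Sum>j. ?a j n)"
      using low_suminf by (rule ext)
    ultimately show ?thesis
      using suminf_mult[OF sb, of \<beta>] by (simp only:)
  qed
  \<comment> \<open>The upper half costs \<open>n powr (3 / 2 - 5 / 4)\<close>, so the bound on \<open>n powr (5 / 2) * b n\<close>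
    loses a factor \<open>n powr (1 / 4)\<close> only.\<close>
  have "\<exists>C'. \<forall>n. real n powr (9 / 4) * b n \<le> C'"
  proof -
    have "Bseq low"
      using low convergent_imp_Bseq convergentI by blast
    then obtain L where L: "L > 0" "\<And>n. norm (low n) \<le> L"
      by (auto simp: Bseq_def)
    let ?H = "2 powr (5 / 4) * C * suminf w"
    have "real n powr (9 / 4) * b n \<le> L + ?H" if "n > 0" for n
    proof -
      have p: "real n powr (9 / 4) = real n powr (- 1 / 4) * real n powr (5 / 2)"
        "real n powr (5 / 4) = real n powr (- 1 / 4) * real n powr (3 / 2)"
        by (simp_all flip: powr_add)
      have "real n powr (9 / 4) * b n = real n powr (- 1 / 4) * (real n powr (5 / 2) * b n)"
        by (simp only: p(1) mult.assoc)
      also have "\<dots> = real n powr (- 1 / 4) * low n + real n powr (5 / 4) * high n"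
        by (simp only: split p(2) distrib_left mult.assoc)
      also have "\<dots> \<le> 1 * L + ?H"
      proof (rule add_mono)
        have "low n \<le> L"
          using L(2)[of n] by simp
        then have "real n powr (- 1 / 4) * low n \<le> real n powr (- 1 / 4) * L"
          by (rule mult_left_mono) simp
        also have "real n powr (- 1 / 4) \<le> 1"
          using that powr_mono[of "- 1 / 4" 0 "real n"] by simp
        then have "real n powr (- 1 / 4) * L \<le> 1 * L"
          using L(1) by (intro mult_right_mono) auto
        finally show "real n powr (- 1 / 4) * low n \<le> 1 * L" .
        show "real n powr (5 / 4) * high n \<le> ?H"
          unfolding high_def by (rule sum_upper_half_le[OF w(1) sw _ b C]) simp
      qed
      finally show ?thesis by simp
    qed
    moreover have "0 \<le> L + ?H"
      using L(1) C[of 0] suminf_nonneg[OF sw w(1)] by simp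
    ultimately have "real n powr (9 / 4) * b n \<le> L + ?H" for n
      by (cases "n = 0") auto
    then show ?thesis by blast
  qed
  then obtain C' where C': "\<And>n. real n powr (9 / 4) * b n \<le> C'" by blast
  have high: "(\<lambda>n. real n powr (3 / 2) * high n) \<longlonglongrightarrow> 0"
  proof (rule tendsto_sandwich)
    let ?H = "2 powr (9 / 4) * C' * suminf w"
    show "\<forall>\<^sub>F n in sequentially. 0 \<le> real n powr (3 / 2) * high n"
      unfolding high_def using w(1) b
      by (intro always_eventually allI mult_nonneg_nonneg sum_nonneg powr_ge_zero)
    show "\<forall>\<^sub>F n in sequentially. real n powr (3 / 2) * high n \<le> real n powr (- 3 / 4) * ?H"
    proof (rule always_eventually, rule allI)
      fix n :: nat
      have "real n powr (9 / 4) * high n \<le> ?H"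
        unfolding high_def by (rule sum_upper_half_le[OF w(1) sw _ b C']) simp
      then have "real n powr (- 3 / 4) * (real n powr (9 / 4) * high n) \<le> real n powr (- 3 / 4) * ?H"
        by (intro mult_left_mono) auto
      then show "real n powr (3 / 2) * high n \<le> real n powr (- 3 / 4) * ?H"
        by (simp add: mult.assoc[symmetric] flip: powr_add)
    qed
    have "(\<lambda>n. real n powr (- 3 / 4)) \<longlonglongrightarrow> 0"
      by real_asymp
    then show "(\<lambda>n. real n powr (- 3 / 4) * ?H) \<longlonglongrightarrow> 0"
      by (rule tendsto_mult_left_zero)
  qed simp
  show "(\<lambda>n. real n powr (5 / 2) * b n) \<longlonglongrightarrow> \<beta> * suminf b"
    unfolding split using tendsto_add[OF low high] by simp
qed

section \<open>Consequences of Otter's asymptotics\<close>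

text \<open>The term \<open>d = n\<close> dominates: any other divisor is at most \<open>n / 2\<close>, so that \<open>\<alpha> ^ n * t d\<close> is at
  most a constant times \<open>\<alpha> ^ (n - d)\<close>, which is exponentially small in \<open>n\<close>.\<close>
lemma divisor_sum_asymptotics:
  fixes t :: "nat \<Rightarrow> nat" and \<alpha> \<beta> :: real
  assumes \<alpha>: "0 < \<alpha>" "\<alpha> < 1"
    and lim: "(\<lambda>n. \<alpha> ^ n * real n powr (5 / 2) * real (t n)) \<longlonglongrightarrow> \<beta>"
  shows "(\<lambda>n. real n powr (3 / 2) * (real (\<Sum>d | d dvd n. d * t d) * \<alpha> ^ n)) \<longlonglongrightarrow> \<beta>"
proof -
  define q where "q = sqrt \<alpha>"
  have q: "0 < q" "q < 1" "q ^ 2 = \<alpha>"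
    using \<alpha> by (auto simp: q_def)
  have "Bseq (\<lambda>n. \<alpha> ^ n * real n powr (5 / 2) * real (t n))"
    using lim convergent_imp_Bseq convergentI by blast
  then obtain D where D: "D > 0" "\<And>n. norm (\<alpha> ^ n * real n powr (5 / 2) * real (t n)) \<le> D"
    by (auto simp: Bseq_def)
  have t: "\<alpha> ^ n * real (t n) \<le> D" if "n > 0" for n
  proof -
    have "1 \<le> real n powr (5 / 2)"
      using that by (intro ge_one_powr_ge_zero) auto
    then have "\<alpha> ^ n * real (t n) * 1 \<le> \<alpha> ^ n * real (t n) * real n powr (5 / 2)"
      using \<alpha> by (intro mult_left_mono) auto
    then show ?thesis
      using D(2)[of n] \<alpha> by (simp add: mult_ac)
  qed
  define r where "r n = real (\<Sum>d | d dvd n \<and> d < n. d * t d) * \<alpha> ^ n" for n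
  have r: "r n \<le> D * real n ^ 2 * q ^ n" for n
  proof -
    have "r n = (\<Sum>d | d dvd n \<and> d < n. real d * (\<alpha> ^ n * real (t d)))"
      by (simp add: r_def sum_distrib_left sum_distrib_right mult_ac)
    also have "\<dots> \<le> (\<Sum>d | d dvd n \<and> d < n. real n * (q ^ n * D))"
    proof (rule sum_mono)
      fix d assume "d \<in> {d. d dvd n \<and> d < n}"
      then obtain e where e: "n = d * e" and "d < n"
        by (auto elim: dvdE)
      then have "d > 0" "e \<noteq> 0" "e \<noteq> 1"
        by (auto intro: Nat.gr0I)
      then have "2 \<le> e" by simp
      then have "d * 2 \<le> n"
        unfolding e by (rule mult_le_mono2)
      have "\<alpha> ^ n * real (t d) = \<alpha> ^ (n - d) * (\<alpha> ^ d * real (t d))"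
        using \<open>d < n\<close> by (simp flip: power_add mult.assoc)
      also have "\<dots> \<le> q ^ n * D"
      proof (intro mult_mono t \<open>d > 0\<close>)
        have "\<alpha> ^ (n - d) = q ^ (2 * (n - d))"
          by (simp add: power_mult q(3))
        also have "\<dots> \<le> q ^ n"
          using q \<open>d * 2 \<le> n\<close> by (intro power_decreasing) auto
        finally show "\<alpha> ^ (n - d) \<le> q ^ n" .
      qed (use q \<alpha> in auto)
      finally show "real d * (\<alpha> ^ n * real (t d)) \<le> real n * (q ^ n * D)"
        using \<open>d < n\<close> \<alpha> by (intro mult_mono[of "real d" "real n"]) auto
    qed
    also have "\<dots> = real (card {d. d dvd n \<and> d < n}) * (real n * (q ^ n * D))"
      by simp
    also have "\<dots> \<le> real n * (real n * (q ^ n * D))"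
    proof (rule mult_right_mono)
      have "card {d. d dvd n \<and> d < n} \<le> card {..<n}"
        by (rule card_mono) auto
      then show "real (card {d. d dvd n \<and> d < n}) \<le> real n" by simp
    qed (use q D(1) in auto)
    finally show ?thesis
      by (simp add: power2_eq_square mult_ac)
  qed
  have "(\<lambda>n. real n powr (3 / 2) * r n) \<longlonglongrightarrow> 0"
  proof (rule tendsto_sandwich)
    show "\<forall>\<^sub>F n in sequentially. 0 \<le> real n powr (3 / 2) * r n"
      unfolding r_def using \<alpha>
      by (intro always_eventually allI mult_nonneg_nonneg of_nat_0_le_iff zero_le_power) auto
    show "\<forall>\<^sub>F n in sequentially. real n powr (3 / 2) * r n \<le> real n powr (3 / 2) * (D * real n ^ 2 * q ^ n)"
      using r by (intro always_eventually allI mult_left_mono) auto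
    show "(\<lambda>n. real n powr (3 / 2) * (D * real n ^ 2 * q ^ n)) \<longlonglongrightarrow> 0"
      using q(1,2) by real_asymp
  qed simp
  then have "(\<lambda>n. \<alpha> ^ n * real n powr (5 / 2) * real (t n) + real n powr (3 / 2) * r n) \<longlonglongrightarrow> \<beta> + 0"
    by (rule tendsto_add[OF lim])
  moreover have "\<forall>\<^sub>F n in sequentially. \<alpha> ^ n * real n powr (5 / 2) * real (t n) + real n powr (3 / 2) * r n
      = real n powr (3 / 2) * (real (\<Sum>d | d dvd n. d * t d) * \<alpha> ^ n)"
    using eventually_gt_at_top[of 0]
  proof eventually_elim
    case (elim n)
    have "{d. d dvd n} = insert n {d. d dvd n \<and> d < n}"
      using elim by (auto dest: dvd_imp_le)
    then have "(\<Sum>d | d dvd n. d * t d) = n * t n + (\<Sum>d | d dvd n \<and> d < n. d * t d)"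
      by simp
    moreover have "real n powr (5 / 2) = real n * real n powr (3 / 2)"
      using powr_mult_base[of "real n" "3 / 2"] by simp
    ultimately show ?case
      by (simp add: r_def algebra_simps)
  qed
  ultimately show ?thesis
    using Lim_transform_eventually by fastforce
qed

text \<open>For \<open>\<alpha> \<ge> 1\<close> the hypothesis would force the integers \<open>t n\<close> to tend to \<open>0\<close>,
  hence to vanish eventually, which contradicts \<open>\<beta> > 0\<close>.\<close>
lemma exponential_growth_rate_less_1:
  fixes t :: "nat \<Rightarrow> nat" and \<alpha> \<beta> :: real
  assumes lim: "(\<lambda>n. \<alpha> ^ n * real n powr p * real (t n)) \<longlonglongrightarrow> \<beta>" and "\<beta> > 0" and "p > 0"
  shows "\<alpha> < 1"
proof (rule ccontr)
  assume "\<not> \<alpha> < 1"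
  then have \<alpha>: "\<alpha> ^ n \<ge> 1" for n
    by (simp add: one_le_power)
  have "filterlim (\<lambda>n. real n powr p) at_top sequentially"
    using \<open>p > 0\<close> by real_asymp
  then have "\<forall>\<^sub>F n in sequentially. \<beta> + 1 \<le> real n powr p"
    by (simp add: filterlim_at_top)
  moreover have "\<forall>\<^sub>F n in sequentially. \<alpha> ^ n * real n powr p * real (t n) < \<beta> + 1"
    using lim by (rule order_tendstoD) simp
  moreover have "\<forall>\<^sub>F n in sequentially. 0 < \<alpha> ^ n * real n powr p * real (t n)"
    using lim \<open>\<beta> > 0\<close> by (rule order_tendstoD)
  ultimately have "\<forall>\<^sub>F n :: nat in sequentially. False"
  proof eventually_elim
    case (elim n)
    then have "t n > 0"
      by (auto intro: Nat.gr0I)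
    then have "1 \<le> real (t n)" by simp
    have "\<beta> + 1 \<le> 1 * real n powr p * 1"
      using elim by simp
    also have "\<dots> \<le> \<alpha> ^ n * real n powr p * real (t n)"
      using \<alpha>[of n] \<open>1 \<le> real (t n)\<close> by (intro mult_mono) auto
    finally show ?case
      using elim by simp
  qed
  then show False by simp
qed

section \<open>The number of unlabeled forests\<close>

lemma num_unlabeled_forests_eq_weighted_msets:
  "num_unlabeled_forests n = card (weighted_msets fst tree_shapes n)"
  by (simp add: num_unlabeled_forests_eq weighted_msets_def)

lemma num_unlabeled_forests_recurrence:
  "n * num_unlabeled_forests n
    = (\<Sum>k\<le>n. (\<Sum>d | d dvd k. d * num_unlabeled_trees d) * num_unlabeled_forests (n - k))"
  using weighted_msets_recurrence[of tree_shapes fst n, OF tree_shapes_pos finite_tree_shapes_fibre]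
  by (simp add: num_unlabeled_forests_eq_weighted_msets card_tree_shapes_fibre)

theorem corollary4:
  fixes \<alpha> \<beta> \<rho> :: real
  assumes "\<alpha> > 0" and "\<beta> > 0"
    and otter: "(\<lambda>n. \<alpha> ^ n * real n powr (5 / 2) * real (num_unlabeled_trees n)) \<longlonglongrightarrow> \<beta>"
  defines "\<rho> \<equiv> (\<Prod>k. (1 - \<alpha> ^ Suc k) ^ num_unlabeled_trees (Suc k))"
  shows "(\<lambda>n. real (num_unlabeled_forests n))
           \<sim>[sequentially] (\<lambda>n. real (num_unlabeled_trees n) / \<rho>) \<and>
         (\<lambda>n. \<rho> * real (num_unlabeled_forests n) / real (num_unlabeled_trees n)) \<longlonglongrightarrow> 1"
proof -
  let ?t = num_unlabeled_trees and ?f = num_unlabeled_forests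
  have \<alpha>: "0 < \<alpha>" "\<alpha> < 1"
    using exponential_growth_rate_less_1[OF otter \<open>\<beta> > 0\<close>] \<open>\<alpha> > 0\<close> by auto
  define w where "w k = real (\<Sum>d | d dvd k. d * ?t d) * \<alpha> ^ k" for k
  define b where "b n = real (?f n) * \<alpha> ^ n" for n
  have rec: "real n * b n = (\<Sum>k\<le>n. w k * b (n - k))" for n
  proof -
    have "real n * b n = real (n * ?f n) * \<alpha> ^ n"
      by (simp add: b_def)
    also have "\<dots> = (\<Sum>k\<le>n. real (\<Sum>d | d dvd k. d * ?t d) * real (?f (n - k)) * \<alpha> ^ n)"
      by (simp only: num_unlabeled_forests_recurrence of_nat_sum of_nat_mult sum_distrib_right)
    also have "\<dots> = (\<Sum>k\<le>n. w k * b (n - k))"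
    proof (rule sum.cong[OF refl])
      fix k assume "k \<in> {..n}"
      then have "\<alpha> ^ n = \<alpha> ^ k * \<alpha> ^ (n - k)"
        by (simp flip: power_add)
      then show "real (\<Sum>d | d dvd k. d * ?t d) * real (?f (n - k)) * \<alpha> ^ n = w k * b (n - k)"
        by (simp add: w_def b_def)
    qed
    finally show ?thesis .
  qed
  have w: "w n \<ge> 0" and b: "b n \<ge> 0" for n
    unfolding w_def b_def using \<alpha> by (intro mult_nonneg_nonneg of_nat_0_le_iff zero_le_power; simp)+
  \<comment> \<open>Every number divides \<open>0\<close>, and a sum over an infinite set is \<open>0\<close>.\<close>
  have "w 0 = 0"
    by (simp add: w_def)
  have "(\<lambda>n. real n powr (3 / 2) * w n) \<longlonglongrightarrow> \<beta>"
    unfolding w_def by (rule divisor_sum_asymptotics[OF \<alpha> otter])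
  note asymp = convolution_recurrence_asymptotics[OF w \<open>w 0 = 0\<close> b rec this]
  define B where "B = suminf b"
  have b_eq: "b = (\<lambda>n. real (card (weighted_msets fst tree_shapes n)) * \<alpha> ^ n)"
    by (rule ext) (simp add: b_def num_unlabeled_forests_eq_weighted_msets)
  have "B > 0"
    unfolding B_def b_eq
    by (rule weighted_msets_partial_products(1))
      (use tree_shapes_pos finite_tree_shapes_fibre \<alpha> asymp(1) b_eq in auto)
  have "(\<lambda>K. \<Prod>k\<in>{1..K}. (1 - \<alpha> ^ k) ^ ?t k) \<longlonglongrightarrow> 1 / B"
    unfolding B_def b_eq card_tree_shapes_fibre[symmetric]
    by (rule weighted_msets_partial_products(2))
      (use tree_shapes_pos finite_tree_shapes_fibre \<alpha> asymp(1) b_eq in auto)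
  moreover have "(\<Prod>k\<in>{1..K}. (1 - \<alpha> ^ k) ^ ?t k) = (\<Prod>k<K. (1 - \<alpha> ^ Suc k) ^ ?t (Suc k))" for K
    by (rule prod.reindex_bij_witness[where i = Suc and j = "\<lambda>k. k - 1"]) auto
  ultimately have "(\<lambda>K. \<Prod>k<K. (1 - \<alpha> ^ Suc k) ^ ?t (Suc k)) \<longlonglongrightarrow> 1 / B"
    by simp
  then have \<rho>: "\<rho> = 1 / B"
    unfolding \<rho>_def using \<open>B > 0\<close> by (intro prodinf_eq_prod_lim') auto
  have "(\<lambda>n. \<rho> * ((real n powr (5 / 2) * b n) / (\<alpha> ^ n * real n powr (5 / 2) * real (?t n))))
      \<longlonglongrightarrow> \<rho> * ((\<beta> * B) / \<beta>)"
    unfolding B_def by (intro tendsto_mult_left tendsto_divide asymp(2) otter) (use \<open>\<beta> > 0\<close> in simp)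
  moreover have "\<rho> * ((\<beta> * B) / \<beta>) = 1"
    using \<rho> \<open>\<beta> > 0\<close> \<open>B > 0\<close> by simp
  moreover have "\<forall>\<^sub>F n in sequentially.
      \<rho> * ((real n powr (5 / 2) * b n) / (\<alpha> ^ n * real n powr (5 / 2) * real (?t n)))
      = \<rho> * real (?f n) / real (?t n)"
    using eventually_gt_at_top[of 0]
    by eventually_elim (use \<alpha> in \<open>simp add: b_def\<close>)
  ultimately have lim: "(\<lambda>n. \<rho> * real (?f n) / real (?t n)) \<longlonglongrightarrow> 1"
    using Lim_transform_eventually by fastforce
  moreover from this have "(\<lambda>n. real (?f n)) \<sim>[sequentially] (\<lambda>n. real (?t n) / \<rho>)"
    by (intro asymp_equivI') (simp add: mult.commute)
  ultimately show ?thesis by blast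
qed

end
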